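(* There exist universal constants $C_0,c>0$ such that the following holds. Let $\mathbb{K}\in\{\mathbb{R},\mathbb{C}\}$ and let $A\in\mathbb{K}^{m\times n}$ be nonzero with rank $k$ and stable rank $r=\|A\|_F^2/\|A\|_2^2$. Let $0<\varepsilon<\sigma_k(A)/\|A\|_2$, $\delta\in(0,1)$, and let $d_1\in\{1,\dots,m\}$, $d_2\in\{1,\dots,n\}$ satisfy $$d_1,d_2\ \ge\ C_0\,\frac{r}{\varepsilon^4\delta}\log\Big(\frac{r}{\varepsilon^4\delta}\Big).$$ Let $R=A(I,:)$ be the $d_1\times n$ matrix consisting of $d_1$ rows of $A$ chosen independently with replacement, where row $i$ is chosen with probability $p_i=\|A(i,:)\|_2^2/\|A\|_F^2$. Let $C=A(:,J)$ be the $m\times d_2$ matrix consisting of $d_2$ columns of $A$ chosen independently with replacement, where column $i$ is chosen with probability $q_i=\|A(:,i)\|_2^2/\|A\|_F^2$; the choice of columns is independent of the choice of rows. Let $U=A(I,J)$. Then with probability at least $(1-2\exp(-c/\delta))^2$, $$\operatorname{rank}(U)=k\quad\text{and}\quad A=CU^\dagger R.$$ Moreover, the same conclusion holds if $I$ and $J$ are replaced by $I_0$ and $J_0$, the indices of $I$ and $J$ without repeated entries (and $R,C,U$ are replaced by $A(I_0,:)$, $A(:,J_0)$, $A(I_0,J_0)$).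
   Context: $\|\cdot\|_2$ is the spectral norm of a matrix (Euclidean norm of a vector), $\|\cdot\|_F$ the Frobenius norm, $\sigma_1(A)\ge\sigma_2(A)\ge\cdots$ the singular values, and $U^\dagger$ the Moore--Penrose pseudoinverse. $A(i,:)$ and $A(:,i)$ are the $i$-th row and column of $A$. For index lists $I=(i_1,\dots,i_{d_1})$, $J=(j_1,\dots,j_{d_2})$ (possibly with repetitions), $A(I,:)$ has $a$-th row $A(i_a,:)$, $A(:,J)$ has $b$-th column $A(:,j_b)$, and $A(I,J)$ has $(a,b)$ entry $A_{i_a,j_b}$. *)

theory Defs
  imports "HOL-Probability.Probability" "Jordan_Normal_Form.DL_Rank"
    "Jordan_Normal_Form.Schur_Decomposition" "Jordan_Normal_Form.Char_Poly"
begin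

no_notation vec_nth (infixl "$" 90)
hide_type (open) Finite_Cartesian_Product.vec

text \<open>
  All notions are polymorphic over the common type class of \<^typ>\<open>real\<close> and \<^typ>\<open>complex\<close>;
  only these two instances are of interest. Indices start at 0.
\<close>

definition vec_l2 :: "'a::real_normed_field vec \<Rightarrow> real"
  where "vec_l2 v = L2_set (\<lambda>i. norm (v $ i)) {..<dim_vec v}"

definition frobenius_norm :: "'a::real_normed_field mat \<Rightarrow> real"
  where "frobenius_norm A = L2_set (\<lambda>ij. norm (A $$ ij)) ({..<dim_row A} \<times> {..<dim_col A})"

definition spectral_norm :: "'a::real_normed_field mat \<Rightarrow> real"
  where "spectral_norm A =
    (SUP v\<in>{v \<in> carrier_vec (dim_col A). vec_l2 v \<le> 1}. vec_l2 (A *\<^sub>v v))"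

definition stable_rank :: "'a::real_normed_field mat \<Rightarrow> real"
  where "stable_rank A = (frobenius_norm A)\<^sup>2 / (spectral_norm A)\<^sup>2"

definition mat_rank :: "'a::field mat \<Rightarrow> nat"
  where "mat_rank A = vec_space.rank (dim_row A) A"

text \<open>
  The singular values in decreasing order and with multiplicity: the square roots of the
  eigenvalues of the Gram matrix, which is Hermitian positive semidefinite, so that its
  characteristic polynomial splits already over the base field and \<^term>\<open>norm z\<close> merely converts
  a nonnegative real eigenvalue \<^term>\<open>z\<close> to type \<^typ>\<open>real\<close>.
  The list has length \<^term>\<open>dim_col A\<close>, i.e.\ it may be padded with zeros at the end.
\<close>

definition singular_values :: "'a::{conjugatable_field, real_normed_field} mat \<Rightarrow> real list"
  where "singular_values A =
    rev (sorted_list_of_multiset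
      (image_mset (\<lambda>z. sqrt (norm z)) (proots (char_poly (mat_adjoint A * A)))))"

text \<open>The \<open>j\<close>-th largest singular value, counted from \<open>j = 1\<close>.\<close>

definition singular_value :: "nat \<Rightarrow> 'a::{conjugatable_field, real_normed_field} mat \<Rightarrow> real"
  where "singular_value j A = singular_values A ! (j - 1)"

definition is_pseudoinverse :: "'a::conjugatable_field mat \<Rightarrow> 'a mat \<Rightarrow> bool"
  where "is_pseudoinverse A X \<longleftrightarrow>
    X \<in> carrier_mat (dim_col A) (dim_row A) \<and>
    A * X * A = A \<and> X * A * X = X \<and>
    mat_adjoint (A * X) = A * X \<and> mat_adjoint (X * A) = X * A"

definition pseudoinverse :: "'a::conjugatable_field mat \<Rightarrow> 'a mat"
  where "pseudoinverse A = (THE X. is_pseudoinverse A X)"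

text \<open>\<open>A(I,:)\<close>, \<open>A(:,J)\<close> and \<open>A(I,J)\<close> for index lists, possibly with repetitions.\<close>

definition select_rows :: "'a mat \<Rightarrow> nat list \<Rightarrow> 'a mat"
  where "select_rows A I = mat (length I) (dim_col A) (\<lambda>(a, j). A $$ (I ! a, j))"

definition select_cols :: "'a mat \<Rightarrow> nat list \<Rightarrow> 'a mat"
  where "select_cols A J = mat (dim_row A) (length J) (\<lambda>(i, b). A $$ (i, J ! b))"

definition select_mat :: "'a mat \<Rightarrow> nat list \<Rightarrow> nat list \<Rightarrow> 'a mat"
  where "select_mat A I J = mat (length I) (length J) (\<lambda>(a, b). A $$ (I ! a, J ! b))"

definition row_pmf :: "'a::real_normed_field mat \<Rightarrow> nat pmf"
  where "row_pmf A = embed_pmf (\<lambda>i.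
    if i < dim_row A then (vec_l2 (row A i))\<^sup>2 / (frobenius_norm A)\<^sup>2 else 0)"

definition col_pmf :: "'a::real_normed_field mat \<Rightarrow> nat pmf"
  where "col_pmf A = embed_pmf (\<lambda>j.
    if j < dim_col A then (vec_l2 (col A j))\<^sup>2 / (frobenius_norm A)\<^sup>2 else 0)"

text \<open>
  The joint law of the pair of index lists: \<open>d1\<close> independent rows and, independently of them,
  \<open>d2\<close> independent columns.
\<close>

definition index_pmf :: "'a::real_normed_field mat \<Rightarrow> nat \<Rightarrow> nat \<Rightarrow> (nat list \<times> nat list) pmf"
  where "index_pmf A d1 d2 =
    pair_pmf (replicate_pmf d1 (row_pmf A)) (replicate_pmf d2 (col_pmf A))"

text \<open>The weights are nonnegative and sum to 1, so \<^const>\<open>embed_pmf\<close> gives the intended laws.\<close>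

lemma frobenius_norm_rows:
  "(frobenius_norm A)\<^sup>2 = (\<Sum>i<dim_row A. (vec_l2 (row A i))\<^sup>2)"
  by (simp add: frobenius_norm_def vec_l2_def L2_set_def sum_nonneg sum.cartesian_product
      case_prod_unfold)

lemma frobenius_norm_cols:
  "(frobenius_norm A)\<^sup>2 = (\<Sum>j<dim_col A. (vec_l2 (col A j))\<^sup>2)"
proof -
  have "(frobenius_norm A)\<^sup>2 = (\<Sum>i<dim_row A. \<Sum>j<dim_col A. (norm (A $$ (i, j)))\<^sup>2)"
    by (simp add: frobenius_norm_def L2_set_def sum_nonneg sum.cartesian_product case_prod_unfold)
  also have "\<dots> = (\<Sum>j<dim_col A. \<Sum>i<dim_row A. (norm (A $$ (i, j)))\<^sup>2)"
    by (rule sum.swap)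
  finally show ?thesis
    by (simp add: vec_l2_def L2_set_def sum_nonneg)
qed

lemma frobenius_norm_pos:
  assumes "A \<in> carrier_mat m n" "A \<noteq> 0\<^sub>m m n"
  shows "frobenius_norm A > 0"
proof -
  obtain i j where ij: "i < m" "j < n" "A $$ (i, j) \<noteq> 0"
    using assms by (metis carrier_matD eq_matI index_zero_mat)
  have "0 < norm (A $$ (i, j))" using ij by simp
  also have "\<dots> \<le> frobenius_norm A"
    unfolding frobenius_norm_def using assms ij by (intro member_le_L2_set) auto
  finally show ?thesis .
qed

lemma pmf_embed_weights:
  fixes f :: "nat \<Rightarrow> real"
  assumes "\<And>i. f i \<ge> 0" "(\<Sum>i<N. f i) = s" "s > 0"
  shows "pmf (embed_pmf (\<lambda>i. if i < N then f i / s else 0)) i = (if i < N then f i / s else 0)"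
proof (rule pmf_embed_pmf)
  show "0 \<le> (if i < N then f i / s else 0)" for i using assms by simp
  have "(\<integral>\<^sup>+ i. ennreal (if i < N then f i / s else 0) \<partial>count_space UNIV)
      = (\<Sum>i<N. ennreal (if i < N then f i / s else 0))"
    by (rule nn_integral_count_space') auto
  also have "\<dots> = ennreal (\<Sum>i<N. f i / s)"
    using assms by (subst sum_ennreal[symmetric]) auto
  also have "\<dots> = 1" using assms by (simp flip: sum_divide_distrib)
  finally show "(\<integral>\<^sup>+ i. ennreal (if i < N then f i / s else 0) \<partial>count_space UNIV) = 1" .
qed

lemma pmf_row_pmf:
  assumes "A \<in> carrier_mat m n" "A \<noteq> 0\<^sub>m m n"
  shows "pmf (row_pmf A) i = (if i < m then (vec_l2 (row A i))\<^sup>2 / (frobenius_norm A)\<^sup>2 else 0)"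
  unfolding row_pmf_def using frobenius_norm_pos[OF assms] assms(1)
  by (subst pmf_embed_weights) (auto simp: frobenius_norm_rows[symmetric])

lemma pmf_col_pmf:
  assumes "A \<in> carrier_mat m n" "A \<noteq> 0\<^sub>m m n"
  shows "pmf (col_pmf A) j = (if j < n then (vec_l2 (col A j))\<^sup>2 / (frobenius_norm A)\<^sup>2 else 0)"
  unfolding col_pmf_def using frobenius_norm_pos[OF assms] assms(1)
  by (subst pmf_embed_weights) (auto simp: frobenius_norm_cols[symmetric])

definition exact_cur :: "nat \<Rightarrow> 'a::conjugatable_field mat \<Rightarrow> nat list \<Rightarrow> nat list \<Rightarrow> bool"
  where "exact_cur k A I J \<longleftrightarrow>
    (let R = select_rows A I; C = select_cols A J; U = select_mat A I J
     in mat_rank U = k \<and> A = C * pseudoinverse U * R)"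

end

theory Submission
  imports Defs
begin

text \<open>
  No matrix concentration inequality is needed. Let \<open>A = U S V\<^sup>*\<close> be the thin singular value
  decomposition. If the sampled rows of \<open>U S\<close> and the sampled rows of \<open>V S\<close> are injective on the
  \<open>k\<close>-dimensional coefficient space, then the submatrix factors as (left invertible) times (right
  invertible), so it has rank \<open>k\<close> and its pseudoinverse recovers \<open>A\<close>. Under length-squared
  sampling, as long as the rows drawn so far have an \<open>N\<close>-dimensional common kernel, the next row is
  nonzero on that kernel with probability at least \<open>N p\<close>, where
  \<open>p = \<sigma>\<^sub>k\<^sup>2 / |A|\<^sub>F\<^sup>2 \<ge> \<epsilon>\<^sup>2 / r\<close>. Hence the expected kernel dimension after \<open>d\<close> draws is at
  most \<open>k (1 - p)\<^sup>d\<close>, and by Markov this bounds the probability of failure.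
\<close>

subsection \<open>Adjoints, norms and isometries over the real or complex numbers\<close>

text \<open>The row norms of A are those of \<open>U S\<close> and its column norms are those of
  \<open>V S\<close>, so the two sampling laws control exactly these matrices. The factorization
  behind the decomposition is asymmetric, \<open>U S\<close> times the adjoint of V; injectivity
  therefore has to pass from \<open>V S\<close> to V through the invertibility of S. Columns are
  treated as rows of the adjoint of A.

  The obstacle on the numerical side is the factor k in the failure bound. The estimate that yields
  the hitting probability N p also yields k p \<le> 1, because a probability is at most 1. Hence k
  \<le> r / \<epsilon>^2, and the logarithm in the sample size can absorb k.

  Both fields are treated at once in a class whose axiom ties conjugation to the norm; the argument
  distinguishes them only where the characteristic polynomial of the Gram matrix has to
  split.\<close>

class real_or_complex_field = conjugatable_ordered_field + real_normed_field +
  assumes mult_conjugate_scaleR: "a * conjugate a = scaleR ((norm a)\<^sup>2) 1"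

instance real :: real_or_complex_field
  by standard (simp add: power2_eq_square)

instance complex :: real_or_complex_field
  by standard (simp add: complex_mult_cnj cmod_def complex_eq_iff)

lemma mult_conjugate:
  "a * conjugate a = of_real ((norm (a :: 'a::real_or_complex_field))\<^sup>2)"
  by (simp add: mult_conjugate_scaleR of_real_def)

lemma norm_conjugate [simp]: "norm (conjugate (a :: 'a::real_or_complex_field)) = norm a"
proof -
  have "of_real ((norm (conjugate a))\<^sup>2) = (of_real ((norm a)\<^sup>2) :: 'a)"
    by (metis conjugate_id mult.commute mult_conjugate)
  then show ?thesis
    by (simp only: of_real_eq_iff power2_eq_iff_nonneg norm_ge_zero)
qed

lemma conjugate_1 [simp]: "conjugate (1 :: 'a::conjugatable_field) = 1"
  by (metis conjugate_dist_mul conjugate_id mult.right_neutral mult_1)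

text \<open>The class says nothing about conjugates of reals directly; for x \<noteq> 0 its axiom
  gives x * conjugate x = x * x, and x cancels.\<close>

lemma conjugate_of_real [simp]: "conjugate (of_real x :: 'a::real_or_complex_field) = of_real x"
proof (cases "x = 0")
  case False
  have "of_real x * conjugate (of_real x) = (of_real x * of_real x :: 'a)"
    by (simp add: mult_conjugate power2_eq_square)
  then show ?thesis using False by simp
qed simp

lemma conjugate_inverse_of_real:
  "conjugate (inverse (of_real x) :: 'a::real_or_complex_field) = inverse (of_real x)"
  by (metis conjugate_of_real of_real_inverse)

lemma conjugate_diff: "conjugate (a - b :: 'a::conjugatable_field) = conjugate a - conjugate b"
  by (metis conjugate_dist_add conjugate_neg diff_conv_add_uminus)

lemma mat_adjoint_carrier [simp]:
  "A \<in> carrier_mat m n \<Longrightarrow> mat_adjoint A \<in> carrier_mat n m"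
  by (auto simp: mat_adjoint_def)

lemma dim_mat_adjoint [simp]:
  "dim_row (mat_adjoint A) = dim_col A" "dim_col (mat_adjoint A) = dim_row A"
  by (auto simp: mat_adjoint_def)

lemma index_mat_adjoint [simp]:
  "i < dim_col A \<Longrightarrow> j < dim_row A \<Longrightarrow> mat_adjoint A $$ (i, j) = conjugate (A $$ (j, i))"
  by (auto simp: mat_adjoint_def mat_of_rows_def)

lemma mult_mat_adjoint_vec_carrier [simp]:
  "A \<in> carrier_mat m n \<Longrightarrow> mat_adjoint A *\<^sub>v v \<in> carrier_vec n"
  by (intro carrier_vecI) simp

lemma mat_adjoint_adjoint [simp]: "mat_adjoint (mat_adjoint A) = A"
  by (rule eq_matI) auto

lemma mat_adjoint_mult:
  assumes "A \<in> carrier_mat m n" "B \<in> carrier_mat n p"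
  shows "mat_adjoint (A * B) = mat_adjoint B * mat_adjoint A"
  using assms
  by (intro eq_matI)
    (auto simp: scalar_prod_def sum_conjugate conjugate_dist_mul mult.commute intro!: sum.cong)

lemma mat_adjoint_one [simp]: "mat_adjoint (1\<^sub>m n :: 'a::conjugatable_field mat) = 1\<^sub>m n"
  by (rule eq_matI) auto

lemma cscalar_prod_adjoint:
  fixes A :: "'a::conjugatable_field mat"
  assumes "A \<in> carrier_mat m n" "x \<in> carrier_vec n" "y \<in> carrier_vec m"
  shows "(A *\<^sub>v x) \<bullet>c y = x \<bullet>c (mat_adjoint A *\<^sub>v y)"
proof -
  have "(A *\<^sub>v x) \<bullet>c y = (\<Sum>i<m. \<Sum>j<n. A $$ (i, j) * x $ j * conjugate (y $ i))"
    using assms by (auto simp: scalar_prod_def sum_distrib_right atLeast0LessThan)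
  also have "\<dots> = (\<Sum>j<n. \<Sum>i<m. A $$ (i, j) * x $ j * conjugate (y $ i))"
    by (rule sum.swap)
  also have "\<dots> = x \<bullet>c (mat_adjoint A *\<^sub>v y)"
    using assms by (auto simp: scalar_prod_def sum_distrib_left atLeast0LessThan sum_conjugate
        conjugate_dist_mul mult_ac intro!: sum.cong)
  finally show ?thesis .
qed

lemma vec_l2_power2: "(vec_l2 v)\<^sup>2 = (\<Sum>i<dim_vec v. (norm (v $ i))\<^sup>2)"
  by (simp add: vec_l2_def L2_set_def sum_nonneg)

lemma vec_l2_nonneg [simp]: "0 \<le> vec_l2 v"
  by (simp add: vec_l2_def)

lemma cscalar_prod_self:
  fixes v :: "'a::real_or_complex_field vec"
  shows "v \<bullet>c v = of_real ((vec_l2 v)\<^sup>2)"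
  by (simp add: vec_l2_power2 scalar_prod_def mult_conjugate atLeast0LessThan)

lemma vec_l2_eq_0_iff: "v \<in> carrier_vec n \<Longrightarrow> vec_l2 v = 0 \<longleftrightarrow> v = 0\<^sub>v n"
  by (auto simp: vec_l2_def L2_set_eq_0_iff intro!: eq_vecI)

text \<open>Inner products take values in the field, so norm identities are proved there and pulled
  back through the injective \<open>of_real\<close>.\<close>

lemma vec_l2_eqI:
  fixes v w :: "'a::real_or_complex_field vec"
  assumes "v \<bullet>c v = w \<bullet>c w"
  shows "vec_l2 v = vec_l2 w"
  using assms unfolding cscalar_prod_self of_real_eq_iff by (simp add: power2_eq_iff_nonneg)

lemma vec_l2_smult: "vec_l2 (c \<cdot>\<^sub>v v) = norm c * vec_l2 v"
  by (auto simp: vec_l2_def L2_set_right_distrib norm_mult intro!: L2_set_cong)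

lemma vec_l2_isometry:
  fixes Z :: "'a::real_or_complex_field mat"
  assumes Z: "Z \<in> carrier_mat n k" "mat_adjoint Z * Z = 1\<^sub>m k" and x: "x \<in> carrier_vec k"
  shows "vec_l2 (Z *\<^sub>v x) = vec_l2 x"
proof (rule vec_l2_eqI)
  have "(Z *\<^sub>v x) \<bullet>c (Z *\<^sub>v x) = x \<bullet>c (mat_adjoint Z *\<^sub>v (Z *\<^sub>v x))"
    using Z x by (intro cscalar_prod_adjoint) auto
  also have "mat_adjoint Z *\<^sub>v (Z *\<^sub>v x) = x"
    using assoc_mult_mat_vec[of "mat_adjoint Z" k n Z k x] Z x by simp
  finally show "(Z *\<^sub>v x) \<bullet>c (Z *\<^sub>v x) = x \<bullet>c x" .
qed

text \<open>Bessel: \<open>|y|\<^sup>2 - |Z\<^sup>* y|\<^sup>2 = |y - Z Z\<^sup>* y|\<^sup>2\<close> for an isometry \<open>Z\<close>.\<close>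

lemma vec_l2_adjoint_isometry_le:
  fixes Z :: "'a::real_or_complex_field mat"
  assumes Z: "Z \<in> carrier_mat n k" "mat_adjoint Z * Z = 1\<^sub>m k" and y: "y \<in> carrier_vec n"
  shows "vec_l2 (mat_adjoint Z *\<^sub>v y) \<le> vec_l2 y"
proof -
  define c where "c = mat_adjoint Z *\<^sub>v y"
  define z where "z = Z *\<^sub>v c"
  have c: "c \<in> carrier_vec k" using Z y by (auto simp: c_def)
  have z: "z \<in> carrier_vec n" using Z c by (auto simp: z_def)
  have zz: "z \<bullet>c z = c \<bullet>c c"
    using vec_l2_isometry[OF Z c] by (simp add: cscalar_prod_self z_def)
  have zy: "z \<bullet>c y = c \<bullet>c c"
    using cscalar_prod_adjoint[OF Z(1) c y] by (simp add: z_def c_def)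
  have yz: "y \<bullet>c z = c \<bullet>c c"
  proof -
    have "y \<bullet>c z = conjugate (z \<bullet>c y)"
      using y z by (metis comm_scalar_prod conjugate_vec_sprod_comm conjugate_conjugate_sprod carrier_vec_conjugate)
    then show ?thesis by (simp only: zy cscalar_prod_self conjugate_of_real)
  qed
  have "(y - z) \<bullet>c (y - z) = (y \<bullet>c y - y \<bullet>c z) - (z \<bullet>c y - z \<bullet>c z)"
    using y z by (simp add: scalar_prod_def sum_subtractf conjugate_diff ring_distribs)
  then have "of_real ((vec_l2 (y - z))\<^sup>2) = (of_real ((vec_l2 y)\<^sup>2 - (vec_l2 c)\<^sup>2) :: 'a)"
    unfolding zz yz zy unfolding cscalar_prod_self of_real_diff by simp
  then have "(vec_l2 c)\<^sup>2 \<le> (vec_l2 y)\<^sup>2"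
    unfolding of_real_eq_iff by (metis diff_ge_0_iff_ge zero_le_power2)
  then show ?thesis
    unfolding c_def by (rule power2_le_imp_le) simp
qed

subsection \<open>Unitary diagonalization and the singular value decomposition\<close>

lemma index_mat_adjoint_mult:
  fixes A :: "'a::conjugatable_field mat"
  assumes "A \<in> carrier_mat m n" "B \<in> carrier_mat m p" "i < n" "j < p"
  shows "(mat_adjoint A * B) $$ (i, j) = col B j \<bullet>c col A i"
  using assms by (auto simp: scalar_prod_def intro!: sum.cong)

text \<open>Gram-Schmidt on a basis starting with v keeps v as first vector, and normalizing turns
  orthogonality into unitarity. The prescribed first column serves both the deflation of a Hermitian
  matrix and the frame of a hyperplane.\<close>

lemma unitary_completion:
  fixes v :: "'a::real_or_complex_field vec"
  assumes v: "v \<in> carrier_vec n" and v0: "v \<noteq> 0\<^sub>v n"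
  obtains W where "W \<in> carrier_mat n n" "mat_adjoint W * W = 1\<^sub>m n" "W * mat_adjoint W = 1\<^sub>m n"
    "col W 0 = of_real (inverse (vec_l2 v)) \<cdot>\<^sub>v v"
proof -
  interpret cof_vec_space n "TYPE('a)" .
  have n: "n \<noteq> 0" using v v0 by (auto intro: eq_vecI)
  define ws where "ws = gram_schmidt n (basis_completion v)"
  note bc = basis_completion[OF v v0]
  obtain vs where bv: "basis_completion v = v # vs"
    using bc(6,7) n by (cases "basis_completion v") auto
  have ws: "corthogonal ws" "set ws \<subseteq> carrier_vec n" "length ws = n"
    using gram_schmidt_result[OF bc(2,4,5) ws_def] bc(6) by auto
  have "hd ws = v" unfolding ws_def bv by (rule gram_schmidt_hd[OF v])
  then have ws0: "ws ! 0 = v" using ws(3) n hd_conv_nth[of ws] by force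
  have wsj: "ws ! j \<in> carrier_vec n" if "j < n" for j using ws that by auto
  have nz: "vec_l2 (ws ! j) \<noteq> 0" if "j < n" for j
  proof
    assume "vec_l2 (ws ! j) = 0"
    then have "ws ! j \<bullet>c ws ! j = 0" by (simp add: cscalar_prod_self)
    then show False using corthogonalD[OF ws(1), of j j] ws that by auto
  qed
  define u where "u = (\<lambda>j. of_real (inverse (vec_l2 (ws ! j))) \<cdot>\<^sub>v ws ! j)"
  have u: "u j \<in> carrier_vec n" if "j < n" for j using wsj[OF that] by (simp add: u_def)
  define W where "W = mat_of_cols n (map u [0..<n])"
  have W: "W \<in> carrier_mat n n" by (auto simp: W_def)
  have col: "col W j = u j" if "j < n" for j
    unfolding W_def using that u by (subst col_mat_of_cols) auto
  have WW: "mat_adjoint W * W = 1\<^sub>m n"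
  proof (rule eq_matI)
    fix i j assume ij: "i < dim_row (1\<^sub>m n :: 'a mat)" "j < dim_col (1\<^sub>m n :: 'a mat)"
    then have ij: "i < n" "j < n" by auto
    have "(mat_adjoint W * W) $$ (i, j) = u j \<bullet>c u i"
      using index_mat_adjoint_mult[OF W W ij] col ij by simp
    also have "\<dots> = of_real (inverse (vec_l2 (ws ! j))) * of_real (inverse (vec_l2 (ws ! i))) *
        (ws ! j \<bullet>c ws ! i)"
      using wsj[of i] wsj[of j] ij by (auto simp: u_def conjugate_smult_vec mult_ac conjugate_dist_mul
          conjugate_inverse_of_real scalar_prod_def sum_distrib_left intro!: sum.cong)
    also have "\<dots> = 1\<^sub>m n $$ (i, j)"
    proof (cases "i = j")
      case True
      have "of_real (inverse (vec_l2 (ws ! j))) * of_real (inverse (vec_l2 (ws ! j))) * (ws ! j \<bullet>c ws ! j)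
         = (of_real (inverse (vec_l2 (ws ! j)) * inverse (vec_l2 (ws ! j)) * (vec_l2 (ws ! j))\<^sup>2) :: 'a)"
        by (simp only: cscalar_prod_self of_real_mult)
      also have "inverse (vec_l2 (ws ! j)) * inverse (vec_l2 (ws ! j)) * (vec_l2 (ws ! j))\<^sup>2 = 1"
        using nz[OF ij(2)] by (simp add: power2_eq_square field_simps)
      finally show ?thesis using True ij by simp
    next
      case False
      then have "ws ! j \<bullet>c ws ! i = 0" using corthogonalD[OF ws(1), of j i] ws ij by simp
      then show ?thesis using False ij by simp
    qed
    finally show "(mat_adjoint W * W) $$ (i, j) = 1\<^sub>m n $$ (i, j)" .
  qed (use W in auto)
  have "W * mat_adjoint W = 1\<^sub>m n"
    using mat_mult_left_right_inverse[OF mat_adjoint_carrier[OF W] W WW] .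
  moreover have "col W 0 = of_real (inverse (vec_l2 v)) \<cdot>\<^sub>v v"
    using col n by (simp add: u_def ws0)
  ultimately show ?thesis using that W WW by blast
qed

text \<open>Take a unitary matrix whose first column is normal to the hyperplane and drop that
  column. The result carries a problem in dimension \<open>Suc N\<close> to one in dimension N
  without changing norms.\<close>

lemma hyperplane_isometry:
  fixes b :: "'a::real_or_complex_field vec"
  assumes b: "b \<in> carrier_vec (Suc N)" and b0: "b \<noteq> 0\<^sub>v (Suc N)"
  obtains Z where "Z \<in> carrier_mat (Suc N) N" "mat_adjoint Z * Z = 1\<^sub>m N"
    "\<And>x. x \<in> carrier_vec (Suc N) \<Longrightarrow> b \<bullet> x = 0 \<Longrightarrow> \<exists>y\<in>carrier_vec N. x = Z *\<^sub>v y"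
proof -
  \<comment> \<open>The constraint \<open>b \<bullet> x = 0\<close> is bilinear, so its normal
    vector in the Hermitian product is the conjugate of b.\<close>
  define v where "v = conjugate b"
  have v: "v \<in> carrier_vec (Suc N)" "v \<noteq> 0\<^sub>v (Suc N)"
    using b b0 by (auto simp: v_def)
  obtain W where W: "W \<in> carrier_mat (Suc N) (Suc N)" and WW: "mat_adjoint W * W = 1\<^sub>m (Suc N)"
    "W * mat_adjoint W = 1\<^sub>m (Suc N)" and col0: "col W 0 = of_real (inverse (vec_l2 v)) \<cdot>\<^sub>v v"
    using unitary_completion[OF v] .
  define Z where "Z = mat (Suc N) N (\<lambda>(i, j). W $$ (i, Suc j))"
  have Z: "Z \<in> carrier_mat (Suc N) N" by (simp add: Z_def)
  have colZ: "col Z j = col W (Suc j)" if "j < N" for j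
    using that W by (intro eq_vecI) (auto simp: Z_def)
  have "mat_adjoint Z * Z = 1\<^sub>m N"
  proof (rule eq_matI)
    fix i j assume "i < dim_row (1\<^sub>m N :: 'a mat)" "j < dim_col (1\<^sub>m N :: 'a mat)"
    then have ij: "i < N" "j < N" by auto
    have "(mat_adjoint Z * Z) $$ (i, j) = (mat_adjoint W * W) $$ (Suc i, Suc j)"
      using index_mat_adjoint_mult[OF Z Z ij] index_mat_adjoint_mult[OF W W, of "Suc i" "Suc j"] colZ ij
      by simp
    then show "(mat_adjoint Z * Z) $$ (i, j) = 1\<^sub>m N $$ (i, j)" using ij by (simp add: WW)
  qed (use Z in auto)
  moreover have "\<exists>y\<in>carrier_vec N. x = Z *\<^sub>v y" if x: "x \<in> carrier_vec (Suc N)" and bx: "b \<bullet> x = 0" for x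
  proof -
    define c where "c = mat_adjoint W *\<^sub>v x"
    have c: "c \<in> carrier_vec (Suc N)" using W by (simp add: c_def)
    have "c $ 0 = conjugate (col W 0) \<bullet> x"
      using W x by (simp add: c_def scalar_prod_def)
    also have "\<dots> = conjugate (of_real (inverse (vec_l2 v))) * (b \<bullet> x)"
      using b x unfolding col0 by (simp add: v_def conjugate_smult_vec del: of_real_inverse)
    also have "\<dots> = of_real (inverse (vec_l2 v)) * (b \<bullet> x)"
      by (simp only: conjugate_of_real)
    finally have c0: "c $ 0 = 0" unfolding bx by simp
    define y where "y = vec N (\<lambda>j. c $ Suc j)"
    have "x = W *\<^sub>v c"
      using W x WW(2) by (simp add: c_def assoc_mult_mat_vec[of W "Suc N" "Suc N" "mat_adjoint W" "Suc N" x, symmetric])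
    also have "\<dots> = Z *\<^sub>v y"
    proof (rule eq_vecI)
      fix i assume "i < dim_vec (Z *\<^sub>v y)"
      then have i: "i < Suc N" using Z by simp
      have "(W *\<^sub>v c) $ i = (\<Sum>j<Suc N. W $$ (i, j) * c $ j)"
        using W c i by (simp add: scalar_prod_def atLeast0LessThan)
      also have "\<dots> = (\<Sum>j<N. W $$ (i, Suc j) * c $ Suc j)"
        by (simp only: sum.lessThan_Suc_shift c0) simp
      also have "\<dots> = (Z *\<^sub>v y) $ i"
        using i by (simp add: Z_def y_def scalar_prod_def atLeast0LessThan)
      finally show "(W *\<^sub>v c) $ i = (Z *\<^sub>v y) $ i" .
    qed (use Z W in auto)
    finally show ?thesis by (intro bexI[of _ y]) (auto simp: y_def)
  qed
  ultimately show ?thesis using that Z by blast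
qed

lemma mult_block_diag:
  fixes A B C D :: "'a::ring_1 mat"
  assumes "A \<in> carrier_mat k k" "B \<in> carrier_mat k k" "C \<in> carrier_mat l l" "D \<in> carrier_mat l l"
  shows "four_block_mat A (0\<^sub>m k l) (0\<^sub>m l k) C * four_block_mat B (0\<^sub>m k l) (0\<^sub>m l k) D =
    four_block_mat (A * B) (0\<^sub>m k l) (0\<^sub>m l k) (C * D)"
proof -
  have z: "0\<^sub>m k l \<in> carrier_mat k l" "0\<^sub>m l k \<in> carrier_mat l k" by auto
  have "A * B \<in> carrier_mat k k" "C * D \<in> carrier_mat l l" using assms by auto
  then show ?thesis
    unfolding mult_four_block_mat[OF assms(1) z assms(3) assms(2) z assms(4)]
    using assms by simp
qed

definition diag_mat_of :: "'a::zero list \<Rightarrow> 'a mat" where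
  "diag_mat_of es = mat (length es) (length es) (\<lambda>(i, j). if i = j then es ! i else 0)"

lemma diag_mat_of_carrier [simp]: "diag_mat_of es \<in> carrier_mat (length es) (length es)"
  by (simp add: diag_mat_of_def)

text \<open>Deflation: a unitary change of basis starting with an eigenvector splits off e and
  leaves a smaller Hermitian block, whose characteristic polynomial is the remaining product.
  Splitting is a hypothesis so that real matrices are covered. The diagonal follows the given order
  of \<open>es\<close>, which can thus be chosen sorted.\<close>

lemma hermitian_unitary_diagonalization:
  fixes H :: "'a::real_or_complex_field mat"
  assumes "H \<in> carrier_mat n n" "mat_adjoint H = H"
    and "char_poly H = (\<Prod>e\<leftarrow>es. [:- e, 1:])"
  shows "length es = n \<and> (\<exists>W\<in>carrier_mat n n. mat_adjoint W * W = 1\<^sub>m n \<and>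
    mat_adjoint W * H * W = diag_mat_of es)"
  using assms
proof (induction es arbitrary: n H)
  case Nil
  then have "n = 0" using degree_monic_char_poly[of H n] by simp
  then show ?case using Nil by (auto simp: diag_mat_of_def intro!: bexI[of _ "1\<^sub>m 0"] eq_matI)
next
  case (Cons e es n H)
  note H = Cons.prems(1) and adj = Cons.prems(2)
  have cp: "char_poly H = [: -e, 1 :] * (\<Prod>e\<leftarrow>es. [:- e, 1:])" using Cons.prems(3) by simp
  have "monic (\<Prod>e\<leftarrow>es. [:- e, 1:])" by (rule monic_prod_list) auto
  then have "degree (char_poly H) = Suc (degree (\<Prod>e\<leftarrow>es. [:- e, 1:]))"
    unfolding cp by (subst degree_mult_eq) auto
  with degree_monic_char_poly[OF H] obtain n1 where n: "n = Suc n1" by (cases n) auto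
  have "eigenvalue H e" unfolding eigenvalue_root_char_poly[OF H] cp by simp
  then obtain v where v: "v \<in> carrier_vec n" "v \<noteq> 0\<^sub>v n" and ev: "H *\<^sub>v v = e \<cdot>\<^sub>v v"
    using H by (auto simp: eigenvalue_def eigenvector_def)
  obtain W where W: "W \<in> carrier_mat n n" and WW: "mat_adjoint W * W = 1\<^sub>m n"
    "W * mat_adjoint W = 1\<^sub>m n" and col0: "col W 0 = of_real (inverse (vec_l2 v)) \<cdot>\<^sub>v v"
    using unitary_completion[OF v] .
  note W' = mat_adjoint_carrier[OF W]
  define K where "K = mat_adjoint W * H * W"
  have K: "K \<in> carrier_mat n n" using W H by (auto simp: K_def)
  have Kadj: "mat_adjoint K = K"
    using W H W' unfolding K_def
    by (simp add: mat_adjoint_mult[of _ n n _ n] adj assoc_mult_mat[of _ n n _ n _ n] mult_carrier_mat[of _ n n])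
  have "similar_mat_wit K H (mat_adjoint W) W"
    using K H W W' WW by (intro similar_mat_witI[of _ _ n]) (auto simp: K_def)
  then have cpK: "char_poly K = char_poly H"
    by (intro char_poly_similar) (auto simp: similar_mat_def)
  have K0: "K $$ (i, 0) = (if i = 0 then e else 0)" if i: "i < n" for i
  proof -
    have "H *\<^sub>v col W 0 = e \<cdot>\<^sub>v col W 0"
      unfolding col0 using H v ev by (simp add: mult_mat_vec smult_smult_assoc mult.commute)
    then have "col (H * W) 0 = e \<cdot>\<^sub>v col W 0"
      using H W n by (subst col_mult2[of _ n n _ n]) auto
    then have "K $$ (i, 0) = (e \<cdot>\<^sub>v col W 0) \<bullet>c col W i"
      unfolding K_def using index_mat_adjoint_mult[OF W, of "H * W" n i 0] H W W' i n
      by (simp add: assoc_mult_mat[of _ n n _ n _ n] mult_carrier_mat[of _ n n])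
    also have "\<dots> = e * (mat_adjoint W * W) $$ (i, 0)"
      using index_mat_adjoint_mult[OF W W i, of 0] W i n by simp
    finally show ?thesis using i n by (simp add: WW)
  qed
  define M where "M = mat n1 n1 (\<lambda>(i, j). K $$ (Suc i, Suc j))"
  have M: "M \<in> carrier_mat n1 n1" by (simp add: M_def)
  have Madj: "mat_adjoint M = M"
  proof (rule eq_matI)
    fix i j assume "i < dim_row M" "j < dim_col M"
    then have ij: "i < n1" "j < n1" using M by auto
    have "mat_adjoint M $$ (i, j) = mat_adjoint K $$ (Suc i, Suc j)"
      using ij K n by (simp add: M_def)
    then show "mat_adjoint M $$ (i, j) = M $$ (i, j)" using ij by (simp add: Kadj M_def)
  qed (use M in auto)
  define E where "E = mat 1 1 (\<lambda>_. e)"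
  have E: "E \<in> carrier_mat 1 1" by (simp add: E_def)
  \<comment> \<open>Being Hermitian, K inherits the zeros of its first column in its first row; this
    makes it block diagonal rather than merely triangular.\<close>
  have K0': "K $$ (0, j) = 0" if "j < n" "j \<noteq> 0" for j
  proof -
    have "mat_adjoint K $$ (0, j) = 0" using K K0[OF that(1)] that n by simp
    then show ?thesis by (simp add: Kadj)
  qed
  have Kblock: "K = four_block_mat E (0\<^sub>m 1 n1) (0\<^sub>m n1 1) M"
    using K n K0 K0' by (intro eq_matI) (auto simp: E_def M_def)
  have "char_poly K = char_poly E * char_poly M"
    unfolding Kblock by (rule char_poly_four_block_zeros_col[OF E _ M]) simp
  moreover have "char_poly E = [: -e, 1 :]"
    by (simp add: E_def char_poly_defs det_def sign_def)
  ultimately have "char_poly M = (\<Prod>e\<leftarrow>es. [:- e, 1:])"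
    using cp cpK by (metis mult_cancel_left pCons_eq_0_iff zero_neq_one)
  from Cons.IH[OF M Madj this] obtain P where len: "length es = n1" and P: "P \<in> carrier_mat n1 n1"
    and PP: "mat_adjoint P * P = 1\<^sub>m n1" and PMP: "mat_adjoint P * M * P = diag_mat_of es"
    by auto
  define Q where "Q = four_block_mat (1\<^sub>m 1) (0\<^sub>m 1 n1) (0\<^sub>m n1 1) P"
  have Q: "Q \<in> carrier_mat n n" using P n by (auto simp: Q_def)
  note Q' = mat_adjoint_carrier[OF Q]
  have Qadj: "mat_adjoint Q = four_block_mat (1\<^sub>m 1) (0\<^sub>m 1 n1) (0\<^sub>m n1 1) (mat_adjoint P)"
    using P by (intro eq_matI) (auto simp: Q_def)
  have QQ: "mat_adjoint Q * Q = 1\<^sub>m n"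
    unfolding Qadj unfolding Q_def using P PP n
    by (simp add: mult_block_diag[OF _ _ mat_adjoint_carrier])
  have QKQ: "mat_adjoint Q * K * Q = diag_mat_of (e # es)"
  proof -
    have 1: "mat_adjoint Q * K = four_block_mat E (0\<^sub>m 1 n1) (0\<^sub>m n1 1) (mat_adjoint P * M)"
      unfolding Qadj Kblock using mult_block_diag[OF one_carrier_mat E mat_adjoint_carrier[OF P] M] E
      by simp
    have "mat_adjoint Q * K * Q = four_block_mat E (0\<^sub>m 1 n1) (0\<^sub>m n1 1) (mat_adjoint P * M * P)"
      unfolding 1 unfolding Q_def
      using mult_block_diag[OF E one_carrier_mat mult_carrier_mat[OF mat_adjoint_carrier[OF P] M] P] E
      by simp
    also have "\<dots> = diag_mat_of (e # es)"
      unfolding PMP using len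
      by (intro eq_matI) (auto simp: diag_mat_of_def E_def nth_Cons')
    finally show ?thesis .
  qed
  have "mat_adjoint (W * Q) * (W * Q) = 1\<^sub>m n"
  proof -
    have "mat_adjoint (W * Q) * (W * Q) = mat_adjoint Q * ((mat_adjoint W * W) * Q)"
      using W Q W' Q' by (simp add: mat_adjoint_mult[of _ n n _ n] assoc_mult_mat[of _ n n _ n _ n] mult_carrier_mat[of _ n n])
    then show ?thesis using Q QQ by (simp add: WW)
  qed
  moreover have "mat_adjoint (W * Q) * H * (W * Q) = diag_mat_of (e # es)"
  proof -
    have "mat_adjoint (W * Q) * H * (W * Q) = mat_adjoint Q * K * Q"
      using W Q W' Q' H unfolding K_def
      by (simp add: mat_adjoint_mult[of _ n n _ n] assoc_mult_mat[of _ n n _ n _ n] mult_carrier_mat[of _ n n])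
    then show ?thesis by (simp add: QKQ)
  qed
  ultimately show ?case using len n W Q by (auto intro!: bexI[of _ "W * Q"])
qed

text \<open>C is onto because of R, so \<open>B * C\<close> has the column space of B; L makes the
  columns of B independent, so this space has dimension k.\<close>

lemma mat_rank_factorization:
  fixes B :: "'a::field mat"
  assumes B: "B \<in> carrier_mat m k" and C: "C \<in> carrier_mat k n"
    and L: "L \<in> carrier_mat k m" "L * B = 1\<^sub>m k"
    and R: "R \<in> carrier_mat n k" "C * R = 1\<^sub>m k"
  shows "mat_rank (B * C) = k"
proof -
  interpret vec_space "TYPE('a)" m .
  have BC: "B * C \<in> carrier_mat m n" using B C by simp
  have LB: "L *\<^sub>v (B *\<^sub>v x) = x" if "x \<in> carrier_vec k" for x
    using L B that by (simp add: assoc_mult_mat_vec[symmetric])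
  have "col_space (B * C) = col_space B"
  proof -
    have "\<exists>x\<in>carrier_vec k. B *\<^sub>v x = (B * C) *\<^sub>v y" if "y \<in> carrier_vec n" for y
      using that B C by (intro bexI[of _ "C *\<^sub>v y"]) (auto simp: assoc_mult_mat_vec)
    moreover have "\<exists>y\<in>carrier_vec n. (B * C) *\<^sub>v y = B *\<^sub>v x" if x: "x \<in> carrier_vec k" for x
    proof (intro bexI[of _ "R *\<^sub>v x"])
      have "C *\<^sub>v (R *\<^sub>v x) = x"
        using C R x by (simp add: assoc_mult_mat_vec[symmetric])
      then show "(B * C) *\<^sub>v (R *\<^sub>v x) = B *\<^sub>v x"
        using B C R x assoc_mult_mat_vec[of B m k C n "R *\<^sub>v x"] by simp
    qed (use R x in auto)
    ultimately show ?thesis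
      unfolding col_space_eq[OF BC] col_space_eq[OF B] using B C by (auto; metis)
  qed
  \<comment> \<open>Independence concerns the set of columns, so coinciding columns have to be
    excluded separately before k of them can be counted.\<close>
  moreover have dist: "distinct (cols B)"
    unfolding distinct_conv_nth
  proof (intro allI impI notI)
    fix i j assume ij: "i < length (cols B)" "j < length (cols B)" "i \<noteq> j" "cols B ! i = cols B ! j"
    moreover have "B *\<^sub>v unit_vec k l = col B l" if "l < k" for l
      using B that by (intro eq_vecI) auto
    ultimately have "B *\<^sub>v unit_vec k i = B *\<^sub>v unit_vec k j"
      using B by simp
    then have "unit_vec k i = (unit_vec k j :: 'a vec)" by (metis LB unit_vec_carrier)
    then show False using ij B by simp
  qed
  moreover have "lin_indpt (set (cols B))"
  proof
    assume "lin_dep (set (cols B))"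
    from lin_depE[OF B this dist] obtain v
      where v: "v \<in> carrier_vec k" "v \<noteq> 0\<^sub>v k" "B *\<^sub>v v = 0\<^sub>v m" .
    have "v = L *\<^sub>v 0\<^sub>v m" using LB[OF v(1)] v(3) by simp
    also have "\<dots> = 0\<^sub>v k" using L by (intro eq_vecI) auto
    finally show False using v by simp
  qed
  ultimately have "rank (B * C) = k"
    using lin_indpt_full_rank[OF B] by (simp add: rank_def col_space_def)
  then show ?thesis using B by (simp add: mat_rank_def)
qed

section \<open>Ordered singular values and the thin singular value decomposition\<close>

lemma mult_diag_mat_of:
  fixes M :: "'a::comm_ring_1 mat"
  assumes "M \<in> carrier_mat m (length xs)"
  shows "M * diag_mat_of xs = mat m (length xs) (\<lambda>(i, j). M $$ (i, j) * xs ! j)"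
  using assms
  by (intro eq_matI) (auto simp: diag_mat_of_def scalar_prod_def if_distrib sum.delta cong: if_cong)

lemma diag_mat_of_inverse:
  fixes xs :: "'a::field list"
  assumes "\<And>x. x \<in> set xs \<Longrightarrow> x \<noteq> 0"
  shows "diag_mat_of xs * diag_mat_of (map inverse xs) = 1\<^sub>m (length xs)"
  using assms mult_diag_mat_of[of "diag_mat_of xs" "length xs" "map inverse xs"]
  by (auto simp: diag_mat_of_def intro!: eq_matI)

lemma cscalar_prod_smult:
  fixes v w :: "'a::conjugatable_field vec"
  assumes "v \<in> carrier_vec n" "w \<in> carrier_vec n"
  shows "(a \<cdot>\<^sub>v v) \<bullet>c (b \<cdot>\<^sub>v w) = a * conjugate b * (v \<bullet>c w)"
  using assms by (simp add: conjugate_smult_vec mult.assoc)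

text \<open>Matches positions: the definition sorts a multiset of roots, while the diagonalization
  works with a list. For eigenvalues listed by decreasing modulus the two orders agree, since the
  square root is monotone.\<close>

lemma singular_values_eq:
  fixes A :: "'a::real_or_complex_field mat"
  assumes "char_poly (mat_adjoint A * A) = (\<Prod>e\<leftarrow>es. [:- e, 1:])"
    and "sorted_wrt (\<lambda>x y. norm x \<ge> norm y) es"
  shows "singular_values A = map (\<lambda>z. sqrt (norm z)) es"
proof -
  have "proots (\<Prod>e\<leftarrow>es. [:- e, 1:]) = mset es"
  proof (induction es)
    case (Cons e es)
    have "(\<Prod>e\<leftarrow>es. [:- e, 1:]) \<noteq> 0" by (auto simp: prod_list_zero_iff)
    then have "proots ([:- e, 1:] * (\<Prod>e\<leftarrow>es. [:- e, 1:])) =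
        proots [:- e, 1:] + proots (\<Prod>e\<leftarrow>es. [:- e, 1:])"
      by (intro proots_mult) auto
    then show ?case using Cons.IH by simp
  qed simp
  moreover have "sort (map (\<lambda>z. sqrt (norm z)) es) = rev (map (\<lambda>z. sqrt (norm z)) es)"
    using assms(2) by (intro properties_for_sort) (auto simp: sorted_wrt_map sorted_wrt_rev rev_map[symmetric])
  ultimately show ?thesis
    by (simp add: singular_values_def assms(1) flip: mset_map)
qed

text \<open>With W the eigenvectors of the Gram matrix, the columns of \<open>A * W\<close> are
  orthogonal and have the singular values as norms. Normalizing the nonzero ones gives U, and the
  corresponding columns of W give V.\<close>

lemma thin_svd:
  fixes A :: "'a::real_or_complex_field mat"
  assumes A: "A \<in> carrier_mat m n"
    and split: "\<exists>es. char_poly (mat_adjoint A * A) = (\<Prod>e\<leftarrow>es. [:- e, 1:])"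
    and k: "k = mat_rank A"
  obtains U V ss where "U \<in> carrier_mat m k" "V \<in> carrier_mat n k"
    "mat_adjoint U * U = 1\<^sub>m k" "mat_adjoint V * V = 1\<^sub>m k"
    "A = U * diag_mat_of (map of_real ss) * mat_adjoint V"
    "length ss = k" "\<And>l. l < k \<Longrightarrow> ss ! l = singular_values A ! l"
    "sorted_wrt (\<ge>) ss" "\<And>x. x \<in> set ss \<Longrightarrow> x > 0"
proof -
  from split obtain es0 where es0: "char_poly (mat_adjoint A * A) = (\<Prod>e\<leftarrow>es0. [:- e, 1:])" by blast
  \<comment> \<open>Sorting precedes the diagonalization, so that the l-th column of W belongs to
    the l-th largest singular value.\<close>
  define es where "es = rev (sort_key norm es0)"
  have "mset (map (\<lambda>e. [:- e, 1:]) es) = mset (map (\<lambda>e. [:- e, 1:]) es0)"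
    by (simp add: es_def)
  then have es: "char_poly (mat_adjoint A * A) = (\<Prod>e\<leftarrow>es. [:- e, 1:])"
    unfolding es0 by (metis prod_mset_prod_list)
  have "sorted (map norm (sort_key norm es0))" by (rule sorted_sort_key)
  then have sorted: "sorted_wrt (\<lambda>x y. norm x \<ge> norm y) es"
    by (simp add: es_def sorted_wrt_rev sorted_wrt_map)
  define sv where "sv = singular_values A"
  have sv: "sv = map (\<lambda>z. sqrt (norm z)) es"
    unfolding sv_def by (rule singular_values_eq[OF es sorted])
  have svsorted: "sorted_wrt (\<ge>) sv"
    unfolding sv sorted_wrt_map by (rule sorted_wrt_mono_rel[OF _ sorted]) simp
  define G where "G = mat_adjoint A * A"
  have G: "G \<in> carrier_mat n n" "mat_adjoint G = G"
    using A by (auto simp: G_def mat_adjoint_mult[OF mat_adjoint_carrier[OF A] A])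
  from hermitian_unitary_diagonalization[OF G es[folded G_def]] obtain W
    where len: "length es = n" and W: "W \<in> carrier_mat n n" and WW: "mat_adjoint W * W = 1\<^sub>m n"
      and WGW: "mat_adjoint W * G * W = diag_mat_of es" by blast
  have WW': "W * mat_adjoint W = 1\<^sub>m n"
    using mat_mult_left_right_inverse[OF mat_adjoint_carrier[OF W] W WW] .
  define B where "B = A * W"
  have B: "B \<in> carrier_mat m n" using A W by (simp add: B_def)
  have "mat_adjoint B * B = diag_mat_of es"
  proof -
    note W' = mat_adjoint_carrier[OF W] and A' = mat_adjoint_carrier[OF A]
    have "mat_adjoint B * B = mat_adjoint W * mat_adjoint A * (A * W)"
      unfolding B_def mat_adjoint_mult[OF A W] ..
    also have "\<dots> = mat_adjoint W * (mat_adjoint A * (A * W))"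
      by (rule assoc_mult_mat[OF W' A' mult_carrier_mat[OF A W]])
    also have "mat_adjoint A * (A * W) = G * W"
      unfolding G_def by (rule assoc_mult_mat[OF A' A W, symmetric])
    also have "mat_adjoint W * (G * W) = mat_adjoint W * G * W"
      by (rule assoc_mult_mat[OF W' G(1) W, symmetric])
    finally show ?thesis using WGW by simp
  qed
  then have gram: "col B j \<bullet>c col B i = (if i = j then es ! i else 0)" if "i < n" "j < n" for i j
    using index_mat_adjoint_mult[OF B B that] that len by (simp add: diag_mat_of_def)
  have esB: "es ! i = of_real ((vec_l2 (col B i))\<^sup>2)" if "i < n" for i
    using gram[OF that that] by (simp add: cscalar_prod_self)
  have svB: "sv ! i = vec_l2 (col B i)" if "i < n" for i
    using that len by (simp add: sv esB norm_power)
  have lensv: "length sv = n" by (simp add: sv len)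
  \<comment> \<open>Sortedness makes the positive singular values an initial segment; that its
    length is the rank can only be shown once the decomposition is available.\<close>
  define k' where "k' = length (takeWhile (\<lambda>x. 0 < x) sv)"
  define ss where "ss = take k' sv"
  have k'n: "k' \<le> n" using lensv length_takeWhile_le by (metis k'_def)
  have ssTW: "ss = takeWhile (\<lambda>x. 0 < x) sv"
    unfolding ss_def k'_def by (simp add: takeWhile_eq_take[symmetric])
  have sspos: "x > 0" if "x \<in> set ss" for x
    using that set_takeWhileD unfolding ssTW by fastforce
  have lenss: "length ss = k'" using k'n lensv by (simp add: ss_def)
  have ssnth: "ss ! l = sv ! l" if "l < k'" for l using that by (simp add: ss_def)
  have svpos: "sv ! l > 0" if "l < k'" for l
    using that sspos ssnth lenss by (metis nth_mem)
  have svzero: "sv ! l = 0" if l: "k' \<le> l" "l < n" for l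
  proof -
    have "sv ! l \<le> sv ! k'"
      using svsorted l lensv by (cases "l = k'") (auto simp: sorted_wrt_iff_nth_less)
    moreover have "\<not> 0 < sv ! k'"
      using nth_length_takeWhile[of "\<lambda>x. 0 < x" sv] l lensv by (simp add: k'_def)
    moreover have "sv ! l \<ge> 0" using svB[OF l(2)] by simp
    ultimately show ?thesis by simp
  qed
  define U where "U = mat m k' (\<lambda>(i, j). inverse (of_real (sv ! j)) * B $$ (i, j))"
  define V where "V = mat n k' (\<lambda>(i, j). W $$ (i, j))"
  have U: "U \<in> carrier_mat m k'" and V: "V \<in> carrier_mat n k'" by (auto simp: U_def V_def)
  have colU: "col U j = inverse (of_real (sv ! j)) \<cdot>\<^sub>v col B j" if "j < k'" for j
    using that B k'n by (intro eq_vecI) (auto simp: U_def)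
  have colV: "col V j = col W j" if "j < k'" for j
    using that W k'n by (intro eq_vecI) (auto simp: V_def)
  have VV: "mat_adjoint V * V = 1\<^sub>m k'"
  proof (rule eq_matI)
    fix i j assume "i < dim_row (1\<^sub>m k' :: 'a mat)" "j < dim_col (1\<^sub>m k' :: 'a mat)"
    then have ij: "i < k'" "j < k'" by auto
    then have ijn: "i < n" "j < n" using k'n by auto
    have "(mat_adjoint V * V) $$ (i, j) = (mat_adjoint W * W) $$ (i, j)"
      using index_mat_adjoint_mult[OF V V ij] index_mat_adjoint_mult[OF W W ijn] colV ij by simp
    then show "(mat_adjoint V * V) $$ (i, j) = 1\<^sub>m k' $$ (i, j)"
      using ij ijn by (simp add: WW)
  qed (use V in auto)
  have UU: "mat_adjoint U * U = 1\<^sub>m k'"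
  proof (rule eq_matI)
    fix i j assume "i < dim_row (1\<^sub>m k' :: 'a mat)" "j < dim_col (1\<^sub>m k' :: 'a mat)"
    then have ij: "i < k'" "j < k'" by auto
    then have ijn: "i < n" "j < n" using k'n by auto
    have "(mat_adjoint U * U) $$ (i, j) = inverse (of_real (sv ! j)) * inverse (of_real (sv ! i)) *
        (col B j \<bullet>c col B i)"
      unfolding index_mat_adjoint_mult[OF U U ij] colU[OF ij(1)] colU[OF ij(2)]
      using B by (subst cscalar_prod_smult[of _ m]) (auto simp: conjugate_inverse_of_real)
    also have "\<dots> = 1\<^sub>m k' $$ (i, j)"
    proof (cases "i = j")
      case True
      define s where "s = vec_l2 (col B i)"
      have s: "sv ! i = s" "es ! i = of_real (s\<^sup>2)" "s > 0"
        using svpos[OF ij(1)] svB[OF ijn(1)] esB[OF ijn(1)] by (simp_all add: s_def)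
      have "inverse (of_real s) * inverse (of_real s) * of_real (s\<^sup>2) = (1 :: 'a)"
        using s(3) by (simp add: power2_eq_square field_simps)
      then show ?thesis using True ij ijn s by (simp add: gram)
    qed (use ij ijn in \<open>simp add: gram\<close>)
    finally show "(mat_adjoint U * U) $$ (i, j) = 1\<^sub>m k' $$ (i, j)" .
  qed (use U in auto)
  define S where "S = (diag_mat_of (map of_real ss) :: 'a mat)"
  have S: "S \<in> carrier_mat k' k'"
    using diag_mat_of_carrier[of "map of_real ss :: 'a list"] by (simp add: S_def lenss)
  have US: "U * S = mat m k' (\<lambda>(i, j). B $$ (i, j))"
    unfolding S_def using U lenss svpos
    by (subst mult_diag_mat_of[of _ m]) (auto simp: U_def ssnth less_imp_neq[symmetric] intro!: eq_matI)
  have A_eq: "A = U * S * mat_adjoint V"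
  proof (rule eq_matI)
    fix i j assume "i < dim_row (U * S * mat_adjoint V)" "j < dim_col (U * S * mat_adjoint V)"
    then have ij: "i < m" "j < n" using U V by auto
    have "A = B * mat_adjoint W"
      unfolding B_def using assoc_mult_mat[OF A W mat_adjoint_carrier[OF W]] A by (simp add: WW')
    then have "A $$ (i, j) = (\<Sum>l<n. B $$ (i, l) * conjugate (W $$ (j, l)))"
      using ij B W by (simp add: scalar_prod_def atLeast0LessThan)
    \<comment> \<open>Beyond \<open>k'\<close> the columns of B have norm zero, so their terms drop
      out.\<close>
    also have "\<dots> = (\<Sum>l<k'. B $$ (i, l) * conjugate (W $$ (j, l)))"
    proof (rule sum.mono_neutral_right)
      show "\<forall>l\<in>{..<n} - {..<k'}. B $$ (i, l) * conjugate (W $$ (j, l)) = 0"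
      proof
        fix l assume l: "l \<in> {..<n} - {..<k'}"
        then have "vec_l2 (col B l) = 0" using svzero[of l] svB[of l] by auto
        then have "col B l = 0\<^sub>v m" using vec_l2_eq_0_iff[of "col B l" m] B by auto
        then have "col B l $ i = 0" using ij by simp
        then show "B $$ (i, l) * conjugate (W $$ (j, l)) = 0" using l ij B by simp
      qed
    qed (use k'n in auto)
    also have "\<dots> = (U * S * mat_adjoint V) $$ (i, j)"
      using ij V unfolding US by (simp add: scalar_prod_def atLeast0LessThan V_def)
    finally show "A $$ (i, j) = (U * S * mat_adjoint V) $$ (i, j)" .
  qed (use A U V in auto)
  \<comment> \<open>U has its adjoint as left inverse, and \<open>S * mat_adjoint V\<close> has the
    right inverse \<open>V * T\<close> with T inverse to S, so the rank is the common inner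
    dimension.\<close>
  have "mat_rank A = k'"
  proof -
    define T where "T = diag_mat_of (map inverse (map of_real ss :: 'a list))"
    have T: "T \<in> carrier_mat k' k'"
      using diag_mat_of_carrier[of "map inverse (map of_real ss :: 'a list)"] by (simp add: T_def lenss)
    have ST: "S * T = 1\<^sub>m k'"
      unfolding S_def T_def using sspos by (subst diag_mat_of_inverse) (auto simp: lenss dest!: sspos)
    note V' = mat_adjoint_carrier[OF V]
    have "A = U * (S * mat_adjoint V)" unfolding A_eq by (rule assoc_mult_mat[OF U S V'])
    moreover have "S * mat_adjoint V * (V * T) = 1\<^sub>m k'"
    proof -
      have "S * mat_adjoint V * (V * T) = S * (mat_adjoint V * (V * T))"
        by (rule assoc_mult_mat[OF S V' mult_carrier_mat[OF V T]])
      also have "mat_adjoint V * (V * T) = T"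
        using assoc_mult_mat[OF V' V T] T by (simp add: VV)
      finally show ?thesis by (simp add: ST)
    qed
    ultimately show ?thesis
      using mat_rank_factorization[OF U mult_carrier_mat[OF S V'] mat_adjoint_carrier[OF U] UU
          mult_carrier_mat[OF V T]] by simp
  qed
  then have k: "k = k'" using k by simp
  show ?thesis
    unfolding k
    by (rule that[unfolded k, OF U V UU VV A_eq[unfolded S_def] lenss])
      (use ssnth svsorted sspos in \<open>auto simp: sv_def ss_def intro: sorted_wrt_take\<close>)
qed

subsection \<open>Pseudoinverses and exact CUR decompositions\<close>

text \<open>\<open>A * X\<close> and \<open>A * Y\<close> are self-adjoint idempotents with the
  range of A, hence the same orthogonal projector; likewise \<open>X * A\<close> and
  \<open>Y * A\<close>. Then X = XAX = YAX = YAY. This is what gives the definite description in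
  \<open>pseudoinverse\<close> its value.\<close>

lemma is_pseudoinverse_unique:
  fixes A :: "'a::conjugatable_field mat"
  assumes X: "is_pseudoinverse A X" and Y: "is_pseudoinverse A Y"
  shows "X = Y"
proof -
  obtain m n where A: "A \<in> carrier_mat m n" by auto
  have Xc: "X \<in> carrier_mat n m" and X1: "A * X * A = A" "X * A * X = X"
    "mat_adjoint (A * X) = A * X" "mat_adjoint (X * A) = X * A"
    using X A by (auto simp: is_pseudoinverse_def)
  have Yc: "Y \<in> carrier_mat n m" and Y1: "A * Y * A = A" "Y * A * Y = Y"
    "mat_adjoint (A * Y) = A * Y" "mat_adjoint (Y * A) = Y * A"
    using Y A by (auto simp: is_pseudoinverse_def)
  have AX: "A * X \<in> carrier_mat m m" and AY: "A * Y \<in> carrier_mat m m"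
    and XA: "X * A \<in> carrier_mat n n" and YA: "Y * A \<in> carrier_mat n n"
    using A Xc Yc by auto
  have "A * X = (A * Y) * (A * X)"
    using assoc_mult_mat[OF AY A Xc] by (simp add: Y1)
  then have "A * X = mat_adjoint ((A * Y) * (A * X))" by (metis X1(3))
  also have "\<dots> = (A * X) * (A * Y)"
    unfolding mat_adjoint_mult[OF AY AX] by (simp add: X1 Y1)
  also have "\<dots> = A * Y"
    using assoc_mult_mat[OF AX A Yc] by (simp add: X1)
  finally have 1: "A * X = A * Y" .
  have "X * A = (X * A) * (Y * A)"
    using assoc_mult_mat[OF Xc A YA] assoc_mult_mat[OF A Yc A] by (simp add: Y1)
  then have "X * A = mat_adjoint ((X * A) * (Y * A))" by (metis X1(4))
  also have "\<dots> = (Y * A) * (X * A)"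
    unfolding mat_adjoint_mult[OF XA YA] by (simp add: X1 Y1)
  also have "\<dots> = Y * A"
    using assoc_mult_mat[OF Yc A XA] assoc_mult_mat[OF A Xc A] by (simp add: X1)
  finally have 2: "X * A = Y * A" .
  have "X = Y * A * X" using X1(2) 2 by simp
  also have "\<dots> = Y * (A * X)" by (rule assoc_mult_mat[OF Yc A Xc])
  also have "\<dots> = Y * A * Y" unfolding 1 by (rule assoc_mult_mat[OF Yc A Yc, symmetric])
  finally show ?thesis using Y1(2) by simp
qed

lemma pseudoinverse_eqI: "is_pseudoinverse A X \<Longrightarrow> pseudoinverse A = X"
  unfolding pseudoinverse_def using is_pseudoinverse_unique by (intro the_equality) blast+

text \<open>Normal equations: \<open>mat_adjoint B * B\<close> is nonsingular because any x in its
  kernel satisfies |B x| = 0. This choice of left inverse makes \<open>B * L\<close> an orthogonal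
  projector, as the Penrose conditions demand.\<close>

lemma injective_left_inverse:
  fixes B :: "'a::real_or_complex_field mat"
  assumes B: "B \<in> carrier_mat d k"
    and inj: "\<And>x. x \<in> carrier_vec k \<Longrightarrow> B *\<^sub>v x = 0\<^sub>v d \<Longrightarrow> x = 0\<^sub>v k"
  obtains L where "L \<in> carrier_mat k d" "L * B = 1\<^sub>m k" "mat_adjoint (B * L) = B * L"
proof -
  note B' = mat_adjoint_carrier[OF B]
  define G where "G = mat_adjoint B * B"
  have G: "G \<in> carrier_mat k k" unfolding G_def by (rule mult_carrier_mat[OF B' B])
  have Gadj: "mat_adjoint G = G"
    unfolding G_def mat_adjoint_mult[OF B' B] by simp
  have "det G \<noteq> 0"
  proof
    assume "det G = 0"
    then obtain x where x: "x \<in> carrier_vec k" "x \<noteq> 0\<^sub>v k" "G *\<^sub>v x = 0\<^sub>v k"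
      unfolding det_0_iff_vec_prod_zero[OF G] by blast
    have Bx: "B *\<^sub>v x \<in> carrier_vec d" using B x by auto
    have "(B *\<^sub>v x) \<bullet>c (B *\<^sub>v x) = x \<bullet>c (G *\<^sub>v x)"
      unfolding G_def cscalar_prod_adjoint[OF B x(1) Bx] assoc_mult_mat_vec[OF B' B x(1)] ..
    also have "\<dots> = 0" using x by simp
    finally have "B *\<^sub>v x = 0\<^sub>v d"
      using Bx by (simp add: cscalar_prod_self vec_l2_eq_0_iff)
    then show False using inj x by blast
  qed
  then obtain N where N: "N \<in> carrier_mat k k" "N * G = 1\<^sub>m k" "G * N = 1\<^sub>m k"
    using det_non_zero_imp_unit[OF G, of "TYPE('a)"] G
    by (auto simp: Units_def ring_mat_def)
  have "mat_adjoint N = mat_adjoint N * (G * N)" using N mat_adjoint_carrier[OF N(1)] by simp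
  also have "\<dots> = mat_adjoint N * G * N"
    by (rule assoc_mult_mat[OF mat_adjoint_carrier[OF N(1)] G N(1), symmetric])
  also have "mat_adjoint N * G = mat_adjoint (G * N)"
    unfolding mat_adjoint_mult[OF G N(1)] Gadj ..
  finally have Nadj: "mat_adjoint N = N" using N by simp
  define L where "L = N * mat_adjoint B"
  have L: "L \<in> carrier_mat k d" using N B by (simp add: L_def)
  have "L * B = 1\<^sub>m k"
    unfolding L_def using assoc_mult_mat[OF N(1) B' B] N by (simp add: G_def)
  moreover have "mat_adjoint (B * L) = B * L"
    unfolding mat_adjoint_mult[OF B L]
    unfolding L_def mat_adjoint_mult[OF N(1) B'] Nadj
    using assoc_mult_mat[OF B N(1) B'] by simp
  ultimately show ?thesis using that L by blast
qed

text \<open>Only \<open>set I\<close> enters. Repeated draws are therefore invisible, and the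
  version without repeated indices follows from the same event.\<close>

definition rows_injective :: "'a::ring_1 mat \<Rightarrow> nat list \<Rightarrow> bool" where
  "rows_injective B I \<longleftrightarrow> (\<forall>x\<in>carrier_vec (dim_col B).
    (\<forall>i\<in>set I. row B i \<bullet> x = 0) \<longrightarrow> x = 0\<^sub>v (dim_col B))"

lemma row_select_rows:
  "set I \<subseteq> {..<dim_row A} \<Longrightarrow> a < length I \<Longrightarrow> row (select_rows A I) a = row A (I ! a)"
  by (intro eq_vecI) (auto simp: select_rows_def subset_iff)

lemma rows_injective_remdups [simp]: "rows_injective B (remdups I) = rows_injective B I"
  by (simp add: rows_injective_def)

lemma rows_injective_select_rows:
  assumes "rows_injective B I" "set I \<subseteq> {..<dim_row B}"
    and "x \<in> carrier_vec (dim_col B)" "select_rows B I *\<^sub>v x = 0\<^sub>v (length I)"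
  shows "x = 0\<^sub>v (dim_col B)"
proof -
  have "row B i \<bullet> x = 0" if i: "i \<in> set I" for i
  proof -
    obtain a where a: "a < length I" "I ! a = i" using i unfolding in_set_conv_nth by blast
    have "(select_rows B I *\<^sub>v x) $ a = row B i \<bullet> x"
      using a row_select_rows[OF assms(2) a(1)] by (simp add: select_rows_def)
    then show ?thesis using assms(4) a by simp
  qed
  then show ?thesis using assms(1,3) by (simp add: rows_injective_def)
qed

text \<open>Substituting x = S (T x) turns a vector killed by the chosen rows of B into one killed
  by those of \<open>B * S\<close>. Needed for V, since the sampling controls
  \<open>V * S\<close>.\<close>

lemma rows_injective_mult_right:
  fixes B :: "'a::field mat"
  assumes B: "B \<in> carrier_mat m k" and S: "S \<in> carrier_mat k k" "T \<in> carrier_mat k k" "S * T = 1\<^sub>m k"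
    and I: "set I \<subseteq> {..<m}" and inj: "rows_injective (B * S) I"
  shows "rows_injective B I"
  unfolding rows_injective_def
proof (intro ballI impI)
  fix x assume "x \<in> carrier_vec (dim_col B)" and 0: "\<forall>i\<in>set I. row B i \<bullet> x = 0"
  then have x: "x \<in> carrier_vec k" using B by auto
  have Tx: "T *\<^sub>v x \<in> carrier_vec k" using S x by auto
  have x_eq: "x = S *\<^sub>v (T *\<^sub>v x)"
    using assoc_mult_mat_vec[OF S(1,2) x] S x by simp
  have "row (B * S) i \<bullet> (T *\<^sub>v x) = 0" if "i \<in> set I" for i
  proof -
    have i: "i < m" using I that by auto
    have "row (B * S) i \<bullet> (T *\<^sub>v x) = ((B * S) *\<^sub>v (T *\<^sub>v x)) $ i" using B i by simp
    also have "(B * S) *\<^sub>v (T *\<^sub>v x) = B *\<^sub>v x"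
      using assoc_mult_mat_vec[OF B S(1) Tx] x_eq by simp
    finally show ?thesis using 0 that B i by simp
  qed
  then have "T *\<^sub>v x = 0\<^sub>v k" using inj Tx S B by (auto simp: rows_injective_def)
  then have "x = S *\<^sub>v 0\<^sub>v k" using x_eq by simp
  also have "\<dots> = 0\<^sub>v k" using S by (intro eq_vecI) auto
  finally show "x = 0\<^sub>v (dim_col B)" using B by simp
qed

text \<open>
  With \<open>L\<close> and \<open>M\<close> the one-sided inverses of \<open>B(I,:)\<close> and \<open>C(:,J)\<close> from normal equations,
  \<open>U = B(I,:) C(:,J)\<close> has pseudoinverse \<open>M L\<close>, and \<open>C(:,J) (M L) B(I,:) = 1\<close>.
\<close>

lemma exact_cur_of_factorization:
  fixes B :: "'a::real_or_complex_field mat"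
  assumes B: "B \<in> carrier_mat m k" and C: "C \<in> carrier_mat k n" and A: "A = B * C"
    and I: "set I \<subseteq> {..<m}" "rows_injective B I"
    and J: "set J \<subseteq> {..<n}" "rows_injective (mat_adjoint C) J"
  shows "exact_cur k A I J"
proof -
  define d1 where "d1 = length I"
  define d2 where "d2 = length J"
  define P where "P = select_rows B I"
  define Q where "Q = select_cols C J"
  have P: "P \<in> carrier_mat d1 k" using B by (simp add: P_def d1_def select_rows_def)
  have Q: "Q \<in> carrier_mat k d2" using C by (simp add: Q_def d2_def select_cols_def)
  note Q' = mat_adjoint_carrier[OF Q]
  have Qadj: "mat_adjoint Q = select_rows (mat_adjoint C) J"
    using C J(1) by (intro eq_matI) (auto simp: Q_def select_rows_def select_cols_def subset_iff)
  obtain L where L: "L \<in> carrier_mat k d1" "L * P = 1\<^sub>m k" "mat_adjoint (P * L) = P * L"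
    using rows_injective_select_rows[OF I(2)] I(1) B injective_left_inverse[OF P]
    by (auto simp: P_def d1_def)
  \<comment> \<open>The columns of C are handled as rows of its adjoint; the adjoint of this left
    inverse becomes the right inverse M of Q, with \<open>M * Q\<close> self-adjoint.\<close>
  obtain M' where M': "M' \<in> carrier_mat k d2" "M' * mat_adjoint Q = 1\<^sub>m k"
    "mat_adjoint (mat_adjoint Q * M') = mat_adjoint Q * M'"
    using rows_injective_select_rows[OF J(2)] J(1) C injective_left_inverse[OF Q']
    by (auto simp: Qadj d2_def)
  define M where "M = mat_adjoint M'"
  have M: "M \<in> carrier_mat d2 k" using M' by (simp add: M_def)
  have MQ: "M * Q = mat_adjoint Q * M'"
    using M'(3) mat_adjoint_mult[OF Q' M'(1)] by (simp add: M_def)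
  have MQadj: "mat_adjoint (M * Q) = M * Q"
    unfolding MQ by (rule M'(3))
  have QM: "Q * M = 1\<^sub>m k"
    using arg_cong[OF M'(2), of mat_adjoint] mat_adjoint_mult[OF M'(1) Q'] by (simp add: M_def)
  define U where "U = select_mat A I J"
  have "select_mat A I J = P * Q"
    using B C I(1) J(1)
    by (intro eq_matI)
      (auto simp: A P_def Q_def select_mat_def select_rows_def select_cols_def scalar_prod_def
        subset_iff intro!: sum.cong)
  then have U: "U = P * Q" by (simp add: U_def)
  have rows: "select_rows A I = P * C"
    using B C I(1)
    by (intro eq_matI)
      (auto simp: A P_def select_rows_def scalar_prod_def subset_iff intro!: sum.cong)
  have cols: "select_cols A J = B * Q"
    using B C J(1)
    by (intro eq_matI)
      (auto simp: A Q_def select_cols_def scalar_prod_def subset_iff intro!: sum.cong)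
  define X where "X = M * L"
  have X: "X \<in> carrier_mat d2 d1" using M L by (simp add: X_def)
  have QX: "Q * X = L"
    unfolding X_def using assoc_mult_mat[OF Q M L(1)] L by (simp add: QM)
  have XP: "X * P = M"
    unfolding X_def using assoc_mult_mat[OF M L(1) P] M by (simp add: L)
  have UX: "U * X = P * L"
    unfolding U using assoc_mult_mat[OF P Q X] by (simp add: QX)
  have XU: "X * U = M * Q"
    unfolding U using assoc_mult_mat[OF X P Q] by (simp add: XP)
  have "is_pseudoinverse U X"
    unfolding is_pseudoinverse_def UX XU
  proof (intro conjI)
    show "X \<in> carrier_mat (dim_col U) (dim_row U)" using X P Q by (simp add: U)
    show "P * L * U = U"
      unfolding U using assoc_mult_mat[OF P L(1), of "P * Q" d2] assoc_mult_mat[OF L(1) P Q] P Q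
      by (simp add: L)
    show "M * Q * X = X"
      using assoc_mult_mat[OF M Q X] by (simp add: QX) (simp add: X_def)
  qed (fact L MQadj)+
  then have pinv: "pseudoinverse U = X" by (rule pseudoinverse_eqI)
  have "mat_rank U = k"
    unfolding U by (rule mat_rank_factorization[OF P Q L(1,2) M QM])
  moreover have "select_cols A J * pseudoinverse U * select_rows A I = A"
  proof -
    have BQ: "B * Q \<in> carrier_mat m d2" and BL: "B * L \<in> carrier_mat m d1"
      and PC: "P * C \<in> carrier_mat d1 n"
      using B Q L P C by auto
    have "B * Q * X = B * L"
      using assoc_mult_mat[OF B Q X] by (simp add: QX)
    moreover have "B * L * (P * C) = B * (L * (P * C))"
      by (rule assoc_mult_mat[OF B L(1) PC])
    moreover have "L * (P * C) = C"
      using assoc_mult_mat[OF L(1) P C] C by (simp add: L)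
    ultimately show ?thesis unfolding rows cols pinv by (simp add: A)
  qed
  ultimately show ?thesis by (simp add: exact_cur_def U_def)
qed

subsection \<open>Sampling rows until the kernel is trivial\<close>

lemma prob_bind_pmf:
  "measure_pmf.prob (bind_pmf M N) X = (\<integral>x. measure_pmf.prob (N x) X \<partial>measure_pmf M)"
proof -
  \<comment> \<open>Reading an event as the value \<open>True\<close> of a Boolean pmf makes the
    mass formula for a bind applicable.\<close>
  have *: "measure_pmf.prob p X = pmf (map_pmf (\<lambda>x. x \<in> X) p) True" for p
    by (simp add: pmf_map vimage_def)
  show ?thesis unfolding * by (simp add: map_bind_pmf pmf_bind)
qed

lemma prob_replicate_pmf_Suc:
  fixes q :: "nat pmf"
  assumes "set_pmf q \<subseteq> {..<m}"
  shows "measure_pmf.prob (replicate_pmf (Suc d) q) X =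
    (\<Sum>i<m. pmf q i * measure_pmf.prob (replicate_pmf d q) {I. i # I \<in> X})"
proof -
  have "replicate_pmf (Suc d) q = bind_pmf q (\<lambda>i. map_pmf (\<lambda>I. i # I) (replicate_pmf d q))"
    by (simp add: map_pmf_def)
  then have "measure_pmf.prob (replicate_pmf (Suc d) q) X =
      (\<integral>i. measure_pmf.prob (replicate_pmf d q) {I. i # I \<in> X} \<partial>measure_pmf q)"
    by (simp add: prob_bind_pmf vimage_def)
  also have "\<dots> = (\<Sum>i<m. measure_pmf.prob (replicate_pmf d q) {I. i # I \<in> X} * pmf q i)"
    using assms by (intro integral_measure_pmf_real) auto
  finally show ?thesis by (simp add: mult.commute)
qed

lemma sum_vec_l2_rows_cols:
  fixes B :: "'a::real_normed_field mat"
  shows "(\<Sum>i<dim_row B. (vec_l2 (row B i))\<^sup>2) = (\<Sum>j<dim_col B. (vec_l2 (col B j))\<^sup>2)"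
  using frobenius_norm_rows frobenius_norm_cols by metis

lemma vec_l2_unit_vec:
  assumes "j < n"
  shows "(vec_l2 (unit_vec n j :: 'a::real_normed_field vec))\<^sup>2 = 1"
proof -
  have "(vec_l2 (unit_vec n j :: 'a vec))\<^sup>2 = (\<Sum>i<n. if i = j then 1 else 0)"
    unfolding vec_l2_power2 using assms by (intro sum.cong) auto
  then show ?thesis using assms by simp
qed

text \<open>Double counting of the squared Frobenius norm of B: each of the N columns contributes at
  least p F, by testing \<open>lower\<close> on unit vectors, while the nonzero rows together
  contribute at most F times their probability.\<close>

lemma prob_nonzero_row:
  fixes B :: "'a::real_or_complex_field mat" and q :: "nat pmf"
  assumes B: "B \<in> carrier_mat m N" and F: "F > 0"
    and lower: "\<And>x. x \<in> carrier_vec N \<Longrightarrow> p * F * (vec_l2 x)\<^sup>2 \<le> (vec_l2 (B *\<^sub>v x))\<^sup>2"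
    and upper: "\<And>i. i < m \<Longrightarrow> (vec_l2 (row B i))\<^sup>2 \<le> F * pmf q i"
  shows "real N * p \<le> (\<Sum>i<m. if row B i = 0\<^sub>v N then 0 else pmf q i)"
proof -
  have "F * (real N * p) = (\<Sum>j<N. p * F)" by simp
  also have "\<dots> \<le> (\<Sum>j<N. (vec_l2 (col B j))\<^sup>2)"
  proof (rule sum_mono)
    fix j assume j: "j \<in> {..<N}"
    have "B *\<^sub>v unit_vec N j = col B j" using B j by (intro eq_vecI) auto
    moreover have "(vec_l2 (unit_vec N j :: 'a vec))\<^sup>2 = 1"
      using j by (rule vec_l2_unit_vec[OF lessThan_iff[THEN iffD1]])
    ultimately show "p * F \<le> (vec_l2 (col B j))\<^sup>2"
      using lower[of "unit_vec N j"] by simp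
  qed
  also have "\<dots> = (\<Sum>i<m. (vec_l2 (row B i))\<^sup>2)"
    using sum_vec_l2_rows_cols[of B] B by simp
  also have "\<dots> \<le> (\<Sum>i<m. F * (if row B i = 0\<^sub>v N then 0 else pmf q i))"
  proof (rule sum_mono)
    fix i assume "i \<in> {..<m}"
    moreover have "vec_l2 (row B i) = 0" if "row B i = 0\<^sub>v N"
      using that vec_l2_eq_0_iff[of "row B i" N] by simp
    ultimately show "(vec_l2 (row B i))\<^sup>2 \<le> F * (if row B i = 0\<^sub>v N then 0 else pmf q i)"
      using upper[of i] by auto
  qed
  finally show ?thesis using F by (simp flip: sum_distrib_left)
qed

lemma vec_l2_conjugate [simp]:
  "vec_l2 (conjugate v) = vec_l2 (v :: 'a::real_or_complex_field vec)"
  by (auto simp: vec_l2_def intro!: L2_set_cong)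

text \<open>Lets norm bounds for a matrix acting on vectors apply to the rows of a product.\<close>

lemma row_mult_conjugate:
  fixes B :: "'a::conjugatable_field mat"
  assumes "B \<in> carrier_mat m n" "Z \<in> carrier_mat n k" "i < m"
  shows "row (B * Z) i = conjugate (mat_adjoint Z *\<^sub>v conjugate (row B i))"
  using assms
  by (intro eq_vecI) (auto simp: scalar_prod_def sum_conjugate conjugate_dist_mul mult.commute intro!: sum.cong)

text \<open>
  Instead of following the kernel of the drawn rows, the induction restricts \<open>B\<close> to the
  hyperplane orthogonal to the first drawn row.
\<close>

lemma prob_not_rows_injective:
  fixes B :: "'a::real_or_complex_field mat" and q :: "nat pmf"
  assumes F: "F > 0" and p: "p \<le> 1" and q: "set_pmf q \<subseteq> {..<m}"
    and B: "B \<in> carrier_mat m N"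
    and lower: "\<And>x. x \<in> carrier_vec N \<Longrightarrow> p * F * (vec_l2 x)\<^sup>2 \<le> (vec_l2 (B *\<^sub>v x))\<^sup>2"
    and upper: "\<And>i. i < m \<Longrightarrow> (vec_l2 (row B i))\<^sup>2 \<le> F * pmf q i"
  shows "measure_pmf.prob (replicate_pmf d q) {I. \<not> rows_injective B I} \<le> real N * (1 - p) ^ d"
  using B lower upper
proof (induction d arbitrary: N B)
  case (0 N B)
  \<comment> \<open>Without draws the bound is N itself: trivial for N \<ge> 1, while in dimension 0
    every list is injective.\<close>
  show ?case
  proof (cases "N = 0")
    case True
    then have "{I. \<not> rows_injective B I} = {}"
      using 0 by (auto simp: rows_injective_def)
    then show ?thesis by simp
  next
    case False
    then have "1 \<le> real N" by simp
    then show ?thesis by (intro order_trans[OF measure_pmf.prob_le_1]) simp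
  qed
next
  case (Suc d N B)
  note B = Suc.prems(1)
  define f where "f i = measure_pmf.prob (replicate_pmf d q) {I. \<not> rows_injective B (i # I)}" for i
  \<comment> \<open>A zero row imposes no constraint and leaves the dimension at N, whereas a
    nonzero one lowers it by one; the gap between these two bounds drives the induction.\<close>
  have f_zero: "f i \<le> real N * (1 - p) ^ d" if "row B i = 0\<^sub>v N" for i
  proof -
    have "rows_injective B (i # I) = rows_injective B I" for I
      using that B by (auto simp: rows_injective_def)
    then show ?thesis using Suc.IH[OF Suc.prems] by (simp add: f_def)
  qed
  have f_nonzero: "f i \<le> (real N - 1) * (1 - p) ^ d" if i: "i < m" and nz: "row B i \<noteq> 0\<^sub>v N" for i
  proof -
    have rc: "row B i \<in> carrier_vec N" using B by auto
    have "row B i = 0\<^sub>v N" if "N = 0" using B that by (intro eq_vecI) auto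
    then have "N \<noteq> 0" using nz by blast
    then obtain N' where N: "N = Suc N'" by (cases N) auto
    obtain Z where Z: "Z \<in> carrier_mat N N'" "mat_adjoint Z * Z = 1\<^sub>m N'"
      and hyp: "\<And>x. x \<in> carrier_vec N \<Longrightarrow> row B i \<bullet> x = 0 \<Longrightarrow> \<exists>y\<in>carrier_vec N'. x = Z *\<^sub>v y"
      using hyperplane_isometry[OF rc[unfolded N] nz[unfolded N]] unfolding N by blast
    have BZ: "B * Z \<in> carrier_mat m N'" using B Z by simp
    have BZx: "(B * Z) *\<^sub>v x = B *\<^sub>v (Z *\<^sub>v x)" if "x \<in> carrier_vec N'" for x
      by (rule assoc_mult_mat_vec[OF B Z(1) that])
    have "f i \<le> measure_pmf.prob (replicate_pmf d q) {I. set I \<subseteq> {..<m} \<and> \<not> rows_injective (B * Z) I}"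
    proof -
      \<comment> \<open>Only indices below m denote rows of B, and only for these is
        \<open>row (B * Z) l\<close> tied to \<open>row B l\<close>; hence the detour through the
        support.\<close>
      have supp: "set I \<subseteq> {..<m}" if "I \<in> set_pmf (replicate_pmf d q)" for I
        using that q by (auto simp: set_replicate_pmf lists_eq_set)
      have "f i = measure_pmf.prob (replicate_pmf d q)
          ({I. \<not> rows_injective B (i # I)} \<inter> set_pmf (replicate_pmf d q))"
        by (simp add: f_def measure_Int_set_pmf)
      also have "\<dots> \<le> measure_pmf.prob (replicate_pmf d q)
          {I. set I \<subseteq> {..<m} \<and> \<not> rows_injective (B * Z) I}"
      proof (intro measure_pmf.finite_measure_mono subsetI)
        fix I assume "I \<in> {I. \<not> rows_injective B (i # I)} \<inter> set_pmf (replicate_pmf d q)"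
        then have I: "set I \<subseteq> {..<m}" and not: "\<not> rows_injective B (i # I)"
          using supp by auto
        from not obtain x where x: "x \<in> carrier_vec N" "x \<noteq> 0\<^sub>v N" "row B i \<bullet> x = 0"
          and 0: "\<And>l. l \<in> set I \<Longrightarrow> row B l \<bullet> x = 0"
          using B by (auto simp: rows_injective_def)
        obtain y where y: "y \<in> carrier_vec N'" "x = Z *\<^sub>v y" using hyp[OF x(1,3)] by blast
        have "row (B * Z) l \<bullet> y = 0" if "l \<in> set I" for l
        proof -
          have l: "l < m" using I that by auto
          have "row (B * Z) l \<bullet> y = ((B * Z) *\<^sub>v y) $ l" using B l by simp
          also have "\<dots> = row B l \<bullet> x" unfolding BZx[OF y(1)] y(2)[symmetric] using B l by simp
          finally show ?thesis using 0[OF that] by simp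
        qed
        moreover have "y \<noteq> 0\<^sub>v N'"
        proof
          assume "y = 0\<^sub>v N'"
          then have "x = 0\<^sub>v N" using y Z by (auto intro: eq_vecI)
          then show False using x by simp
        qed
        ultimately have "\<not> rows_injective (B * Z) I"
          using y(1) Z(1) by (auto simp: rows_injective_def)
        then show "I \<in> {I. set I \<subseteq> {..<m} \<and> \<not> rows_injective (B * Z) I}" using I by simp
      qed simp
      finally show ?thesis .
    qed
    also have "\<dots> \<le> measure_pmf.prob (replicate_pmf d q) {I. \<not> rows_injective (B * Z) I}"
      by (intro measure_pmf.finite_measure_mono) auto
    also have "\<dots> \<le> real N' * (1 - p) ^ d"
    \<comment> \<open>Both bounds survive the restriction with the same constants: Z preserves
      norms, and its adjoint contracts, so rows only get shorter.\<close>
    proof (rule Suc.IH[OF BZ])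
      fix x :: "'a vec" assume x: "x \<in> carrier_vec N'"
      have "Z *\<^sub>v x \<in> carrier_vec N" using Z x by auto
      then show "p * F * (vec_l2 x)\<^sup>2 \<le> (vec_l2 ((B * Z) *\<^sub>v x))\<^sup>2"
        using Suc.prems(2)[of "Z *\<^sub>v x"] vec_l2_isometry[OF Z x] BZx[OF x] by simp
    next
      fix l assume l: "l < m"
      have "row B l \<in> carrier_vec N" using B by auto
      then have "vec_l2 (row (B * Z) l) \<le> vec_l2 (row B l)"
        unfolding row_mult_conjugate[OF B Z(1) l]
        using vec_l2_adjoint_isometry_le[OF Z, of "conjugate (row B l)"] by simp
      then have "(vec_l2 (row (B * Z) l))\<^sup>2 \<le> (vec_l2 (row B l))\<^sup>2" by (intro power_mono) auto
      then show "(vec_l2 (row (B * Z) l))\<^sup>2 \<le> F * pmf q l" using Suc.prems(3)[OF l] by (rule order_trans)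
    qed
    finally show ?thesis by (simp add: N)
  qed
  \<comment> \<open>The sum of g is the probability of a nonzero row, at least N p. The expected
    remaining dimension N minus this sum is thus at most N (1 - p), which supplies the new
    factor.\<close>
  define g where "g i = (if row B i = 0\<^sub>v N then 0 else pmf q i)" for i
  have "measure_pmf.prob (replicate_pmf (Suc d) q) {I. \<not> rows_injective B I} = (\<Sum>i<m. pmf q i * f i)"
    unfolding prob_replicate_pmf_Suc[OF q] f_def by simp
  also have "\<dots> \<le> (\<Sum>i<m. (real N * pmf q i - g i) * (1 - p) ^ d)"
  proof (rule sum_mono)
    fix i assume i: "i \<in> {..<m}"
    have "f i \<le> (real N - (if row B i = 0\<^sub>v N then 0 else 1)) * (1 - p) ^ d"
      using f_zero[of i] f_nonzero[of i] i by simp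
    then have "pmf q i * f i \<le> pmf q i * ((real N - (if row B i = 0\<^sub>v N then 0 else 1)) * (1 - p) ^ d)"
      by (intro mult_left_mono) auto
    also have "\<dots> = (real N * pmf q i - g i) * (1 - p) ^ d"
      by (simp add: g_def algebra_simps)
    finally show "pmf q i * f i \<le> (real N * pmf q i - g i) * (1 - p) ^ d" .
  qed
  also have "\<dots> = (real N - sum g {..<m}) * (1 - p) ^ d"
    using sum_pmf_eq_1[OF _ q] by (simp add: sum_subtractf flip: sum_distrib_left sum_distrib_right)
  also have "\<dots> \<le> (real N - real N * p) * (1 - p) ^ d"
    using prob_nonzero_row[OF B F Suc.prems(2,3)] p unfolding g_def by (intro mult_right_mono) auto
  also have "\<dots> = real N * (1 - p) ^ Suc d" by (simp add: algebra_simps)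
  finally show ?case .
qed

section \<open>Splitting of the characteristic polynomial of a Gram matrix over either field\<close>

lemma char_poly_gram_splits_complex:
  fixes A :: "complex mat"
  shows "\<exists>es. char_poly (mat_adjoint A * A) = (\<Prod>e\<leftarrow>es. [:- e, 1:])"
proof -
  have "mat_adjoint A * A \<in> carrier_mat (dim_col A) (dim_col A)" by (rule carrier_matI) simp_all
  from char_poly_factorized[OF this] show ?thesis by blast
qed

text \<open>Over the complex numbers the polynomial splits, and its roots are real as eigenvalues of
  a Hermitian matrix; so the factorization descends along the injective embedding of the
  reals.\<close>

lemma char_poly_gram_splits_real:
  fixes A :: "real mat"
  shows "\<exists>es. char_poly (mat_adjoint A * A) = (\<Prod>e\<leftarrow>es. [:- e, 1:])"
proof -
  interpret map_poly_hom: map_poly_inj_idom_hom "of_real :: real \<Rightarrow> complex" ..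
  define n where "n = dim_col A"
  define G where "G = mat_adjoint A * A"
  have A: "A \<in> carrier_mat (dim_row A) n" by (rule carrier_matI) (simp_all add: n_def)
  have G: "G \<in> carrier_mat n n"
    unfolding G_def by (rule mult_carrier_mat[OF mat_adjoint_carrier[OF A] A])
  have Gadj: "mat_adjoint G = G"
    unfolding G_def mat_adjoint_mult[OF mat_adjoint_carrier[OF A] A] by simp
  define H where "H = map_mat complex_of_real G"
  have H: "H \<in> carrier_mat n n" using G by (simp add: H_def)
  have Hadj: "mat_adjoint H = H"
  proof (rule eq_matI)
    fix i j assume "i < dim_row H" "j < dim_col H"
    then have ij: "i < n" "j < n" using H by auto
    have "G $$ (j, i) = mat_adjoint G $$ (i, j)" using G ij by simp
    then show "mat_adjoint H $$ (i, j) = H $$ (i, j)"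
      using G H ij by (simp add: Gadj) (simp add: H_def)
  qed (use H in auto)
  obtain as where as: "char_poly H = (\<Prod>a\<leftarrow>as. [:- a, 1:])"
    using char_poly_factorized[OF H] by blast
  have real: "complex_of_real (Re a) = a" if "a \<in> set as" for a
  proof -
    have "poly (char_poly H) a = 0"
      unfolding as poly_prod_list prod_list_zero_iff using that by force
    then have "eigenvalue H a" by (simp add: eigenvalue_root_char_poly[OF H])
    then obtain v where v: "v \<in> carrier_vec n" "v \<noteq> 0\<^sub>v n" "H *\<^sub>v v = a \<cdot>\<^sub>v v"
      using H by (auto simp: eigenvalue_def eigenvector_def)
    have "a * (v \<bullet>c v) = (H *\<^sub>v v) \<bullet>c v" using v by simp
    also have "\<dots> = v \<bullet>c (H *\<^sub>v v)" unfolding cscalar_prod_adjoint[OF H v(1,1)] Hadj ..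
    also have "\<dots> = cnj a * (v \<bullet>c v)" using v by (simp add: conjugate_smult_vec)
    finally have "a = cnj a" using v by (simp add: conjugate_square_eq_0_vec)
    then show ?thesis by (simp add: complex_eq_iff)
  qed
  have "map_poly complex_of_real (char_poly G) = char_poly H"
    unfolding H_def by (rule of_real_hom.char_poly_hom[OF G, symmetric])
  also have "\<dots> = map_poly complex_of_real (\<Prod>e\<leftarrow>map Re as. [:- e, 1:])"
    unfolding as map_poly_hom.hom_prod_list using real
    by (simp add: o_def of_real_hom.map_poly_pCons_hom cong: map_cong)
  finally have "char_poly G = (\<Prod>e\<leftarrow>map Re as. [:- e, 1:])" by simp
  then show ?thesis unfolding G_def by blast
qed

subsection \<open>Length-squared sampling of a matrix with known singular value decomposition\<close>

lemma diag_mat_of_real: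
  fixes ss :: "real list"
  defines "S \<equiv> (diag_mat_of (map of_real ss) :: 'a::real_or_complex_field mat)"
  shows "S \<in> carrier_mat (length ss) (length ss)" "mat_adjoint S = S"
    "\<And>x. x \<in> carrier_vec (length ss) \<Longrightarrow>
      (vec_l2 (S *\<^sub>v x))\<^sup>2 = (\<Sum>l<length ss. (ss ! l)\<^sup>2 * (norm (x $ l))\<^sup>2)"
proof -
  show S: "S \<in> carrier_mat (length ss) (length ss)" by (simp add: S_def diag_mat_of_def)
  show "mat_adjoint S = S"
    by (rule eq_matI) (auto simp: S_def diag_mat_of_def)
  fix x :: "'a vec" assume x: "x \<in> carrier_vec (length ss)"
  have "(S *\<^sub>v x) $ l = of_real (ss ! l) * x $ l" if "l < length ss" for l
    using that x by (simp add: S_def diag_mat_of_def scalar_prod_def if_distrib[of "\<lambda>c. c * _"]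
        sum.delta cong: if_cong)
  then show "(vec_l2 (S *\<^sub>v x))\<^sup>2 = (\<Sum>l<length ss. (ss ! l)\<^sup>2 * (norm (x $ l))\<^sup>2)"
    using S by (simp add: vec_l2_power2 norm_mult power_mult_distrib)
qed

text \<open>Transfers the sampling law: with \<open>B = U * S\<close>, the length-squared weights of
  A are the squared row norms of B up to normalization.\<close>

lemma vec_l2_row_mult_adjoint_isometry:
  fixes B :: "'a::real_or_complex_field mat"
  assumes B: "B \<in> carrier_mat m k" and V: "V \<in> carrier_mat n k" "mat_adjoint V * V = 1\<^sub>m k"
    and i: "i < m"
  shows "vec_l2 (row (B * mat_adjoint V) i) = vec_l2 (row B i)"
proof -
  have "row B i \<in> carrier_vec k" using B by auto
  then show ?thesis
    unfolding row_mult_conjugate[OF B mat_adjoint_carrier[OF V(1)] i]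
    using vec_l2_isometry[OF V, of "conjugate (row B i)"] by simp
qed

text \<open>Serves the rank-one case: there the only singular value is the whole Frobenius norm, so
  p = 1.\<close>

lemma frobenius_norm_svd:
  fixes U V :: "'a::real_or_complex_field mat"
  assumes U: "U \<in> carrier_mat m (length ss)" "mat_adjoint U * U = 1\<^sub>m (length ss)"
    and V: "V \<in> carrier_mat n (length ss)" "mat_adjoint V * V = 1\<^sub>m (length ss)"
  shows "(frobenius_norm (U * diag_mat_of (map of_real ss) * mat_adjoint V))\<^sup>2 = (\<Sum>l<length ss. (ss ! l)\<^sup>2)"
proof -
  define B where "B = U * diag_mat_of (map of_real ss)"
  have B: "B \<in> carrier_mat m (length ss)"
    using U diag_mat_of_real(1)[of ss, where ?'a = 'a] by (auto simp: B_def)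
  have "(frobenius_norm (B * mat_adjoint V))\<^sup>2 = (\<Sum>i<m. (vec_l2 (row B i))\<^sup>2)"
    unfolding frobenius_norm_rows using vec_l2_row_mult_adjoint_isometry[OF B V] B by simp
  also have "\<dots> = (\<Sum>l<length ss. (vec_l2 (col B l))\<^sup>2)"
    using sum_vec_l2_rows_cols[of B] B by simp
  also have "\<dots> = (\<Sum>l<length ss. (ss ! l)\<^sup>2)"
  proof (rule sum.cong)
    fix l assume "l \<in> {..<length ss}"
    then have l: "l < length ss" by simp
    have "col B l = of_real (ss ! l) \<cdot>\<^sub>v col U l"
      using U l unfolding B_def by (subst mult_diag_mat_of[of _ m]) (auto simp: mult.commute intro!: eq_vecI)
    moreover have "(vec_l2 (col U l))\<^sup>2 = 1"
    proof -
      have "of_real ((vec_l2 (col U l))\<^sup>2) = (mat_adjoint U * U) $$ (l, l)"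
        using index_mat_adjoint_mult[OF U(1) U(1) l l] by (simp add: cscalar_prod_self)
      also have "\<dots> = of_real 1" using l by (simp add: U(2))
      finally show ?thesis by (simp only: of_real_eq_iff)
    qed
    ultimately show "(vec_l2 (col B l))\<^sup>2 = (ss ! l)\<^sup>2"
      by (simp add: vec_l2_smult power_mult_distrib)
  qed simp
  finally show ?thesis by (simp add: B_def)
qed

text \<open>The l-th right singular vector is a unit vector whose image has norm
  \<open>ss ! l\<close>. The bound yields \<epsilon> \<le> 1 and the positivity of the spectral
  norm.\<close>

lemma svd_le_spectral_norm:
  fixes U V :: "'a::real_or_complex_field mat"
  assumes U: "U \<in> carrier_mat m (length ss)" "mat_adjoint U * U = 1\<^sub>m (length ss)"
    and V: "V \<in> carrier_mat n (length ss)" "mat_adjoint V * V = 1\<^sub>m (length ss)"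
    and l: "l < length ss" "0 \<le> ss ! l"
  shows "ss ! l \<le> spectral_norm (U * diag_mat_of (map of_real ss) * mat_adjoint V)"
proof -
  define S where "S = (diag_mat_of (map of_real ss) :: 'a mat)"
  define A where "A = U * S * mat_adjoint V"
  note S = diag_mat_of_real[where ss = ss and ?'a = 'a, folded S_def]
  note V' = mat_adjoint_carrier[OF V(1)]
  have US: "U * S \<in> carrier_mat m (length ss)" using U S by simp
  have A: "A \<in> carrier_mat m n" unfolding A_def by (rule mult_carrier_mat[OF US V'])
  have Av: "(vec_l2 (A *\<^sub>v v))\<^sup>2 = (\<Sum>l<length ss. (ss ! l)\<^sup>2 * (norm ((mat_adjoint V *\<^sub>v v) $ l))\<^sup>2)"
    if v: "v \<in> carrier_vec n" for v
  proof -
    have w: "mat_adjoint V *\<^sub>v v \<in> carrier_vec (length ss)" using V by simp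
    have Sw: "S *\<^sub>v (mat_adjoint V *\<^sub>v v) \<in> carrier_vec (length ss)" using S w by auto
    have "A *\<^sub>v v = U *\<^sub>v (S *\<^sub>v (mat_adjoint V *\<^sub>v v))"
      unfolding A_def assoc_mult_mat_vec[OF US V' v] assoc_mult_mat_vec[OF U(1) S(1) w] ..
    then show ?thesis using vec_l2_isometry[OF U Sw] S(3)[OF w] by simp
  qed
  \<comment> \<open>A real supremum dominates its members only for a set bounded above; the sum of
    all squared singular values gives a crude bound that suffices.\<close>
  define T where "T = (\<Sum>l<length ss. (ss ! l)\<^sup>2)"
  have T: "T \<ge> 0" by (simp add: T_def sum_nonneg)
  have bound: "vec_l2 (A *\<^sub>v v) \<le> sqrt T" if v: "v \<in> carrier_vec n" "vec_l2 v \<le> 1" for v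
  proof -
    define w where "w = mat_adjoint V *\<^sub>v v"
    have w: "w \<in> carrier_vec (length ss)" using V by (simp add: w_def)
    have "vec_l2 w \<le> 1"
      using vec_l2_adjoint_isometry_le[OF V v(1)] v(2) by (simp add: w_def)
    then have w1: "(vec_l2 w)\<^sup>2 \<le> 1" by (simp add: power_le_one)
    have "(vec_l2 (A *\<^sub>v v))\<^sup>2 = (\<Sum>l<length ss. (ss ! l)\<^sup>2 * (norm (w $ l))\<^sup>2)"
      unfolding Av[OF v(1)] w_def ..
    also have "\<dots> \<le> (\<Sum>l<length ss. T * (norm (w $ l))\<^sup>2)"
      unfolding T_def by (intro sum_mono mult_right_mono member_le_sum) auto
    also have "\<dots> = T * (vec_l2 w)\<^sup>2"
      using w by (simp add: vec_l2_power2 sum_distrib_left)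
    also have "\<dots> \<le> T" using w1 T by (simp add: mult_left_le)
    finally show ?thesis by (rule real_le_rsqrt)
  qed
  define x where "x = V *\<^sub>v unit_vec (length ss) l"
  have x: "x \<in> carrier_vec n" using V by (auto simp: x_def)
  have x1: "(vec_l2 x)\<^sup>2 = 1"
    using vec_l2_isometry[OF V, of "unit_vec (length ss) l"] vec_l2_unit_vec[OF l(1), where ?'a = 'a]
    by (simp add: x_def)
  have "mat_adjoint V *\<^sub>v x = unit_vec (length ss) l"
    unfolding x_def using assoc_mult_mat_vec[OF V' V(1), of "unit_vec (length ss) l"] by (simp add: V(2))
  then have "(vec_l2 (A *\<^sub>v x))\<^sup>2 = (\<Sum>j<length ss. if j = l then (ss ! l)\<^sup>2 else 0)"
    unfolding Av[OF x] using l by (intro sum.cong) auto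
  then have "(vec_l2 (A *\<^sub>v x))\<^sup>2 = (ss ! l)\<^sup>2" using l by simp
  then have Ax: "vec_l2 (A *\<^sub>v x) = ss ! l" using l by (simp add: power2_eq_iff_nonneg)
  have "vec_l2 (A *\<^sub>v x) \<le> spectral_norm A"
    unfolding spectral_norm_def
  proof (rule cSUP_upper)
    show "x \<in> {v \<in> carrier_vec (dim_col A). vec_l2 v \<le> 1}"
      using x x1 A by (auto simp: power2_eq_1_iff)
    show "bdd_above ((\<lambda>v. vec_l2 (A *\<^sub>v v)) ` {v \<in> carrier_vec (dim_col A). vec_l2 v \<le> 1})"
      using bound A by (intro bdd_aboveI2[of _ _ "sqrt T"]) auto
  qed
  then show ?thesis using Ax by (simp add: A_def S_def)
qed

text \<open>The smallest singular value gives the lower bound for \<open>U * S\<close>, and the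
  length-squared weights meet the upper bound with equality. Stated for any decomposition, so that
  it covers A and, with U and V exchanged, its adjoint.\<close>

lemma prob_not_rows_injective_svd:
  fixes U V :: "'a::real_or_complex_field mat" and s :: real
  assumes A0: "A \<noteq> 0\<^sub>m m n"
    and U: "U \<in> carrier_mat m (length ss)" "mat_adjoint U * U = 1\<^sub>m (length ss)"
    and V: "V \<in> carrier_mat n (length ss)" "mat_adjoint V * V = 1\<^sub>m (length ss)"
    and A: "A = U * diag_mat_of (map of_real ss) * mat_adjoint V"
    and ss: "0 < length ss" "0 < s" "\<And>x. x \<in> set ss \<Longrightarrow> s \<le> x"
  defines "p \<equiv> s\<^sup>2 / (frobenius_norm A)\<^sup>2"
  shows "real (length ss) * p \<le> 1"
    "measure_pmf.prob (replicate_pmf d (row_pmf A))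
      {I. \<not> rows_injective (U * diag_mat_of (map of_real ss)) I} \<le> real (length ss) * (1 - p) ^ d"
    "set_pmf (row_pmf A) \<subseteq> {..<m}"
proof -
  define k where "k = length ss"
  define S where "S = (diag_mat_of (map of_real ss) :: 'a mat)"
  define B where "B = U * S"
  define F where "F = (frobenius_norm A)\<^sup>2"
  note S = diag_mat_of_real[where ss = ss and ?'a = 'a, folded S_def k_def]
  note U = U[folded k_def] and V = V[folded k_def]
  have B: "B \<in> carrier_mat m k" using U S by (simp add: B_def)
  have A_eq: "A = B * mat_adjoint V" by (simp add: A B_def S_def)
  have Ac: "A \<in> carrier_mat m n"
    unfolding A_eq by (rule mult_carrier_mat[OF B mat_adjoint_carrier[OF V(1)]])
  have F: "F > 0" using frobenius_norm_pos[OF Ac A0] by (simp add: F_def)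
  have pF: "p * F = s\<^sup>2" using F by (simp add: p_def F_def)
  show supp: "set_pmf (row_pmf A) \<subseteq> {..<m}"
    using pmf_row_pmf[OF Ac A0] by (auto simp: set_pmf_iff split: if_splits)
  have lower: "p * F * (vec_l2 x)\<^sup>2 \<le> (vec_l2 (B *\<^sub>v x))\<^sup>2" if x: "x \<in> carrier_vec k" for x
  proof -
    have Sx: "S *\<^sub>v x \<in> carrier_vec k" using S x by auto
    have "s\<^sup>2 * (vec_l2 x)\<^sup>2 = (\<Sum>l<k. s\<^sup>2 * (norm (x $ l))\<^sup>2)"
      using x by (simp add: vec_l2_power2 sum_distrib_left)
    also have "\<dots> \<le> (\<Sum>l<k. (ss ! l)\<^sup>2 * (norm (x $ l))\<^sup>2)"
      using ss by (intro sum_mono mult_right_mono power_mono) (auto simp: k_def)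
    also have "\<dots> = (vec_l2 (S *\<^sub>v x))\<^sup>2" unfolding S(3)[OF x] k_def ..
    also have "\<dots> = (vec_l2 (B *\<^sub>v x))\<^sup>2"
      unfolding B_def assoc_mult_mat_vec[OF U(1) S(1) x] vec_l2_isometry[OF U Sx] ..
    finally show ?thesis unfolding pF .
  qed
  have upper: "(vec_l2 (row B i))\<^sup>2 \<le> F * pmf (row_pmf A) i" if i: "i < m" for i
    using pmf_row_pmf[OF Ac A0, of i] vec_l2_row_mult_adjoint_isometry[OF B V i] i F
    by (simp add: A_eq[symmetric] F_def)
  \<comment> \<open>Double counting on the whole coefficient space bounds k p by a probability; this
    is what later limits k.\<close>
  have "real k * p \<le> (\<Sum>i<m. if row B i = 0\<^sub>v k then 0 else pmf (row_pmf A) i)"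
    by (rule prob_nonzero_row[OF B F lower upper])
  also have "\<dots> \<le> (\<Sum>i<m. pmf (row_pmf A) i)" by (intro sum_mono) auto
  also have "\<dots> = 1" using sum_pmf_eq_1[OF _ supp] by simp
  finally have kp: "real k * p \<le> 1" .
  then show "real (length ss) * p \<le> 1" by (simp add: k_def)
  have "p \<ge> 0" by (simp add: p_def)
  moreover have "1 \<le> real k" using ss(1) by (simp add: k_def Suc_le_eq)
  ultimately have "p \<le> real k * p" using mult_right_mono[of 1 "real k" p] by simp
  with kp have "p \<le> 1" by simp
  from prob_not_rows_injective[OF F this supp B lower upper]
  show "measure_pmf.prob (replicate_pmf d (row_pmf A))
      {I. \<not> rows_injective (U * diag_mat_of (map of_real ss)) I} \<le> real (length ss) * (1 - p) ^ d"
    by (simp add: B_def S_def k_def)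
qed

text \<open>Conjugation preserves norms, so sampling columns of A is sampling rows of its adjoint,
  with the same normalization.\<close>

lemma col_pmf_eq_row_pmf_adjoint:
  fixes A :: "'a::real_or_complex_field mat"
  shows "col_pmf A = row_pmf (mat_adjoint A)" "frobenius_norm (mat_adjoint A) = frobenius_norm A"
proof -
  have "row (mat_adjoint A) j = conjugate (col A j)" if "j < dim_col A" for j
    using that by (intro eq_vecI) auto
  then have row: "vec_l2 (row (mat_adjoint A) j) = vec_l2 (col A j)" if "j < dim_col A" for j
    using that by simp
  then have "(frobenius_norm (mat_adjoint A))\<^sup>2 = (frobenius_norm A)\<^sup>2"
    by (simp add: frobenius_norm_rows[of "mat_adjoint A"] frobenius_norm_cols[of A])
  then show F: "frobenius_norm (mat_adjoint A) = frobenius_norm A"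
    by (simp add: power2_eq_iff_nonneg frobenius_norm_def)
  show "col_pmf A = row_pmf (mat_adjoint A)"
    unfolding col_pmf_def row_pmf_def by (intro arg_cong[of _ _ embed_pmf] ext) (simp add: row F)
qed

text \<open>
  The case \<open>k = 1\<close> is separate because \<open>ln (r / (\<epsilon> ^ 4 * \<delta>))\<close> may then be arbitrarily close
  to 0; but all rows are parallel, so a single draw suffices.
\<close>

lemma failure_bound:
  fixes p r \<epsilon> \<delta> :: real
  assumes k: "0 < k" "real k * p \<le> 1" "k = 1 \<Longrightarrow> p = 1"
    and r: "0 < r" and eps: "0 < \<epsilon>" "\<epsilon> \<le> 1" "\<epsilon>\<^sup>2 / r \<le> p" and delta: "0 < \<delta>" "\<delta> < 1"
    and d: "0 < d" "real d \<ge> 3 * (r / (\<epsilon> ^ 4 * \<delta>)) * ln (r / (\<epsilon> ^ 4 * \<delta>))"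
  shows "real k * (1 - p) ^ d \<le> exp (- 1 / \<delta>)"
proof (cases "k = 1")
  case True
  \<comment> \<open>Here 1 - p = 0, and d > 0 matters because \<open>0 ^ 0 = 1\<close>.\<close>
  then show ?thesis using k d by (simp add: zero_power)
next
  case False
  then have k2: "2 \<le> k" using k by simp
  define t where "t = r / (\<epsilon> ^ 4 * \<delta>)"
  have p: "0 < p" using eps r by (intro less_le_trans[OF _ eps(3)]) auto
  have e4: "0 < \<epsilon> ^ 4 * \<delta>" using eps delta by simp
  have e42: "\<epsilon> ^ 4 * \<delta> \<le> \<epsilon>\<^sup>2"
  proof -
    have "\<epsilon> ^ 4 * \<delta> = \<epsilon>\<^sup>2 * (\<epsilon>\<^sup>2 * \<delta>)" by (simp add: power4_eq_xxxx power2_eq_square)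
    also have "\<dots> \<le> \<epsilon>\<^sup>2 * (1 * 1)"
      using eps delta by (intro mult_left_mono mult_mono) (auto simp: power_le_one)
    finally show ?thesis by simp
  qed
  \<comment> \<open>k p \<le> 1 and p \<ge> \<epsilon>^2 / r give k \<le> r / \<epsilon>^2, which is
    at most t because \<epsilon>^4 \<delta> \<le> \<epsilon>^2.\<close>
  have kt: "real k \<le> t"
  proof -
    have "real k * (\<epsilon>\<^sup>2 / r) \<le> 1"
      using k(2) mult_left_mono[OF eps(3), of "real k"] by simp
    then have "real k \<le> r / \<epsilon>\<^sup>2" using r eps by (simp add: field_simps)
    also have "\<dots> \<le> t" unfolding t_def using e42 e4 r eps delta by (intro divide_left_mono mult_pos_pos) auto
    finally show ?thesis .
  qed
  have t2: "2 \<le> t" using kt k2 by simp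
  have lnt: "0 < ln t" using t2 by simp
  have half: "1 / 2 \<le> ln t"
    using ln2_ge_two_thirds t2 ln_mono[of 2 t] by linarith
  have "3 * ln t / \<delta> \<le> p * real d"
  proof -
    have "3 * ln t / \<delta> \<le> 3 * ln t / \<delta> / \<epsilon>\<^sup>2"
    proof -
      have "3 * ln t / \<delta> * \<epsilon>\<^sup>2 \<le> 3 * ln t / \<delta> * 1"
        using lnt delta eps by (intro mult_left_mono) (auto simp: power_le_one)
      moreover have "0 < \<epsilon>\<^sup>2" using eps by simp
      ultimately show ?thesis by (subst pos_le_divide_eq) simp_all
    qed
    also have "\<dots> = \<epsilon>\<^sup>2 / r * (3 * t * ln t)"
      using eps r delta by (simp add: t_def field_simps power4_eq_xxxx power2_eq_square)
    also have "\<dots> \<le> p * real d"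
    proof (rule mult_mono)
      show "3 * t * ln t \<le> real d" using d(2) by (simp add: t_def)
      show "0 \<le> 3 * t * ln t" using lnt t2 by simp
    qed (use eps p in auto)
    finally show ?thesis .
  qed
  moreover have "ln t \<le> ln t / \<delta>" using lnt delta by (simp add: field_simps)
  moreover have "1 / \<delta> \<le> 2 * ln t / \<delta>"
    using half delta by (intro divide_right_mono) auto
  \<comment> \<open>Origin of the constant 3: one \<open>ln t / \<delta>\<close> absorbs the factor
    k \<le> t, and the other two together reach 1 / \<delta> because t \<ge> 2.\<close>
  ultimately have le: "ln t - p * real d \<le> - 1 / \<delta>" by simp
  have p1: "0 \<le> 1 - p"
  proof -
    have "p \<le> real k * p" using k2 p by simp
    then show ?thesis using k(2) by simp
  qed
  have "(1 - p) ^ d \<le> exp (- p) ^ d"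
  proof (rule power_mono)
    show "1 - p \<le> exp (- p)" using exp_ge_add_one_self[of "- p"] by simp
    show "0 \<le> 1 - p" by (rule p1)
  qed
  also have "\<dots> = exp (- (p * real d))" by (simp add: exp_of_nat_mult[symmetric] mult.commute)
  finally have "real k * (1 - p) ^ d \<le> t * exp (- (p * real d))"
    using kt t2 p1 by (intro mult_mono) (auto intro: zero_le_power)
  also have "\<dots> = exp (ln t - p * real d)" using t2 by (simp add: exp_diff exp_minus divide_inverse)
  also have "\<dots> \<le> exp (- 1 / \<delta>)" using le by simp
  finally show ?thesis .
qed

text \<open>Independence of I and J lets the probabilities of two good events multiply, whence the
  square: injectivity of \<open>U * S\<close> on I and of \<open>V * S\<close> on J, each failing
  with probability at most exp (-1 / \<delta>).\<close>

lemma prob_exact_cur: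
  fixes A :: "'a::real_or_complex_field mat"
  assumes split: "\<exists>es. char_poly (mat_adjoint A * A) = (\<Prod>e\<leftarrow>es. [:- e, 1:])"
    and A: "A \<in> carrier_mat m n" and A0: "A \<noteq> 0\<^sub>m m n"
    and k: "k = mat_rank A" and r: "r = stable_rank A"
    and eps: "0 < \<epsilon>" "\<epsilon> < singular_value k A / spectral_norm A"
    and delta: "0 < \<delta>" "\<delta> < 1"
    and d1: "d1 \<in> {1..m}" "real d1 \<ge> 3 * (r / (\<epsilon> ^ 4 * \<delta>)) * ln (r / (\<epsilon> ^ 4 * \<delta>))"
    and d2: "d2 \<in> {1..n}" "real d2 \<ge> 3 * (r / (\<epsilon> ^ 4 * \<delta>)) * ln (r / (\<epsilon> ^ 4 * \<delta>))"
  shows "measure_pmf.prob (index_pmf A d1 d2) {(I, J). exact_cur k A I J} \<ge> (1 - 2 * exp (- 1 / \<delta>))\<^sup>2"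
    and "measure_pmf.prob (index_pmf A d1 d2) {(I, J). exact_cur k A (remdups I) (remdups J)}
      \<ge> (1 - 2 * exp (- 1 / \<delta>))\<^sup>2"
proof -
  obtain U V ss where U: "U \<in> carrier_mat m k" "mat_adjoint U * U = 1\<^sub>m k"
    and V: "V \<in> carrier_mat n k" "mat_adjoint V * V = 1\<^sub>m k"
    and A_eq: "A = U * diag_mat_of (map of_real ss) * mat_adjoint V"
    and len: "length ss = k" and ssnth: "\<And>l. l < k \<Longrightarrow> ss ! l = singular_values A ! l"
    and sorted: "sorted_wrt (\<ge>) ss" and sspos: "\<And>x. x \<in> set ss \<Longrightarrow> x > 0"
    using thin_svd[OF A split k] by metis
  define S where "S = (diag_mat_of (map of_real ss) :: 'a mat)"
  note S = diag_mat_of_real[where ss = ss and ?'a = 'a, folded S_def, unfolded len]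
  have US: "U * S \<in> carrier_mat m k" and VS: "V * S \<in> carrier_mat n k" using U V S by auto
  \<comment> \<open>With k = 0 the decomposition is a product through an empty inner dimension,
    hence zero.\<close>
  have kpos: "0 < k"
  proof (rule ccontr)
    assume "\<not> 0 < k"
    then have "A = 0\<^sub>m m n"
      using A US V unfolding A_eq S_def[symmetric] by (intro eq_matI) (auto simp: scalar_prod_def)
    then show False using A0 by simp
  qed
  define s where "s = singular_value k A"
  have s_eq: "s = ss ! (k - 1)" using ssnth[of "k - 1"] kpos by (simp add: s_def singular_value_def)
  have spos: "0 < s" using sspos len kpos by (simp add: s_eq)
  have smin: "s \<le> x" if "x \<in> set ss" for x
  proof -
    obtain l where l: "l < k" "x = ss ! l" using \<open>x \<in> set ss\<close> len by (auto simp: in_set_conv_nth)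
    show ?thesis
    proof (cases "l = k - 1")
      case False
      then have "l < k - 1" using l by simp
      then show ?thesis using sorted l len by (auto simp: s_eq sorted_wrt_iff_nth_less)
    qed (use l s_eq in simp)
  qed
  define F where "F = (frobenius_norm A)\<^sup>2"
  define p where "p = s\<^sup>2 / F"
  have Fpos: "0 < F" using frobenius_norm_pos[OF A A0] by (simp add: F_def)
  have s_le: "s \<le> spectral_norm A"
    unfolding A_eq using svd_le_spectral_norm[of U m ss V n "k - 1"] U V len kpos spos
    by (simp add: s_eq)
  then have Npos: "0 < spectral_norm A" using spos by simp
  have rpos: "0 < r" using Fpos Npos by (simp add: r stable_rank_def F_def)
  have eps1: "\<epsilon> \<le> 1"
  proof -
    have "s / spectral_norm A \<le> 1" using s_le Npos by simp
    then show ?thesis using eps(2) by (simp add: s_def)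
  qed
  \<comment> \<open>The hypothesis gives \<epsilon> |A|_2 \<le> s; squaring and dividing by F turns
    |A|_2^2 / F into 1 / r.\<close>
  have epsp: "\<epsilon>\<^sup>2 / r \<le> p"
  proof -
    have "\<epsilon> * spectral_norm A \<le> s" using eps(2) Npos by (simp add: s_def field_simps)
    then have "(\<epsilon> * spectral_norm A)\<^sup>2 \<le> s\<^sup>2" using eps Npos by (intro power_mono) auto
    then have "(\<epsilon> * spectral_norm A)\<^sup>2 / F \<le> p" unfolding p_def using Fpos by (intro divide_right_mono) auto
    then show ?thesis by (simp add: r stable_rank_def F_def power_mult_distrib)
  qed
  have p1: "p = 1" if "k = 1"
    using frobenius_norm_svd[of U m ss V n] U V len Fpos that
    by (simp add: p_def F_def A_eq[symmetric] s_eq)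
  note rows = prob_not_rows_injective_svd[of A m n U ss V s, unfolded len, OF A0 U V A_eq kpos spos smin,
      folded F_def p_def S_def, folded p_def]
  have B_adj: "mat_adjoint A = V * diag_mat_of (map of_real ss) * mat_adjoint U"
  proof -
    have "mat_adjoint A = V * mat_adjoint (U * S)"
      unfolding A_eq S_def[symmetric] mat_adjoint_mult[OF US mat_adjoint_carrier[OF V(1)]] by simp
    also have "\<dots> = V * (S * mat_adjoint U)"
      unfolding mat_adjoint_mult[OF U(1) S(1)] S(2) ..
    also have "\<dots> = V * S * mat_adjoint U"
      by (rule assoc_mult_mat[OF V(1) S(1) mat_adjoint_carrier[OF U(1)], symmetric])
    finally show ?thesis by (simp add: S_def)
  qed
  have A0': "mat_adjoint A \<noteq> 0\<^sub>m n m"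
  proof
    assume "mat_adjoint A = 0\<^sub>m n m"
    then have "A = mat_adjoint (0\<^sub>m n m)" by (metis mat_adjoint_adjoint)
    also have "\<dots> = 0\<^sub>m m n" by (rule eq_matI) auto
    finally show False using A0 by simp
  qed
  note cols = prob_not_rows_injective_svd[of "mat_adjoint A" n m V ss U s, unfolded len,
      OF A0' V U B_adj kpos spos smin, folded col_pmf_eq_row_pmf_adjoint(1),
      unfolded col_pmf_eq_row_pmf_adjoint(2), folded F_def p_def S_def, folded p_def]
  define a where "a = exp (- 1 / \<delta>)"
  \<comment> \<open>Multiplying the two bounds 1 - 2 a requires them to be nonnegative; \<delta> < 1
    gives a \<le> exp (-1).\<close>
  have a: "a \<le> 1 / 2"
  proof -
    have "a \<le> exp (- 1)" unfolding a_def using delta by (simp add: field_simps)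
    also have "\<dots> \<le> 1 / 2" using exp_ge_add_one_self[of 1] by (simp add: exp_minus field_simps)
    finally show ?thesis .
  qed
  have a0: "0 \<le> a" by (simp add: a_def)
  have fail: "real k * (1 - p) ^ d \<le> a"
    if "0 < d" "real d \<ge> 3 * (r / (\<epsilon> ^ 4 * \<delta>)) * ln (r / (\<epsilon> ^ 4 * \<delta>))" for d
    unfolding a_def by (rule failure_bound[OF kpos rows(1) p1 rpos eps(1) eps1 epsp delta that])
  have compl: "measure_pmf.prob M {x. P x} = 1 - measure_pmf.prob M {x. \<not> P x}"
    for M :: "nat list pmf" and P
    using measure_pmf.prob_compl[of "{x. \<not> P x}" M] by (simp add: Collect_neg_eq[symmetric] Compl_eq_Diff_UNIV[symmetric])
  define X where "X = {I. rows_injective (U * S) I}"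
  define Y where "Y = {J. rows_injective (V * S) J}"
  have X: "1 - 2 * a \<le> measure_pmf.prob (replicate_pmf d1 (row_pmf A)) X"
    using compl[of "replicate_pmf d1 (row_pmf A)" "rows_injective (U * S)"] rows(2)[of d1] fail[of d1] d1 a0
    by (simp add: X_def)
  have Y: "1 - 2 * a \<le> measure_pmf.prob (replicate_pmf d2 (col_pmf A)) Y"
    using compl[of "replicate_pmf d2 (col_pmf A)" "rows_injective (V * S)"] cols(2)[of d2] fail[of d2] d2 a0
    by (simp add: Y_def)
  have "(1 - 2 * a)\<^sup>2 \<le> measure_pmf.prob (replicate_pmf d1 (row_pmf A)) X *
      measure_pmf.prob (replicate_pmf d2 (col_pmf A)) Y"
    unfolding power2_eq_square using X Y a by (intro mult_mono) auto
  also have "\<dots> = measure_pmf.prob (index_pmf A d1 d2) (X \<times> Y)"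
    unfolding index_pmf_def by (rule measure_pmf_prob_product[symmetric]) auto
  \<comment> \<open>Intersecting with the support costs no probability and keeps all indices in
    range, as \<open>exact\<close> assumes.\<close>
  also have "\<dots> = measure_pmf.prob (index_pmf A d1 d2) (X \<times> Y \<inter> set_pmf (index_pmf A d1 d2))"
    by (simp add: measure_Int_set_pmf)
  finally have good: "(1 - 2 * a)\<^sup>2 \<le>
    measure_pmf.prob (index_pmf A d1 d2) (X \<times> Y \<inter> set_pmf (index_pmf A d1 d2))" .
  define T where "T = diag_mat_of (map inverse (map of_real ss :: 'a list))"
  have T: "T \<in> carrier_mat k k"
    by (rule carrier_matI) (simp_all add: T_def diag_mat_of_def len)
  have ST: "S * T = 1\<^sub>m k"
    unfolding S_def T_def using sspos by (subst diag_mat_of_inverse) (auto simp: len dest!: sspos)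
  have exact: "exact_cur k A I J"
    if IJ: "rows_injective (U * S) I" "rows_injective (V * S) J" "set I \<subseteq> {..<m}" "set J \<subseteq> {..<n}" for I J
  proof -
    have "rows_injective V J"
      by (rule rows_injective_mult_right[OF V(1) S(1) T ST IJ(4,2)])
    then show ?thesis
      using exact_cur_of_factorization[OF US mat_adjoint_carrier[OF V(1)] _ IJ(3,1) IJ(4)] A_eq
      by (simp add: S_def)
  qed
  have sub: "set I \<subseteq> {..<m}" "set J \<subseteq> {..<n}" if "(I, J) \<in> set_pmf (index_pmf A d1 d2)" for I J
    using that rows(3) cols(3) by (auto simp: index_pmf_def set_replicate_pmf lists_eq_set)
  have "measure_pmf.prob (index_pmf A d1 d2) (X \<times> Y \<inter> set_pmf (index_pmf A d1 d2))
      \<le> measure_pmf.prob (index_pmf A d1 d2) {(I, J). exact_cur k A I J}"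
    using exact sub by (intro measure_pmf.finite_measure_mono) (auto simp: X_def Y_def)
  with good show "measure_pmf.prob (index_pmf A d1 d2) {(I, J). exact_cur k A I J} \<ge> (1 - 2 * exp (- 1 / \<delta>))\<^sup>2"
    by (simp add: a_def)
  \<comment> \<open>Removing repetitions changes neither the index sets nor injectivity, so the same
    event works.\<close>
  have "measure_pmf.prob (index_pmf A d1 d2) (X \<times> Y \<inter> set_pmf (index_pmf A d1 d2))
      \<le> measure_pmf.prob (index_pmf A d1 d2) {(I, J). exact_cur k A (remdups I) (remdups J)}"
    using exact sub by (intro measure_pmf.finite_measure_mono) (auto simp: X_def Y_def)
  with good show "measure_pmf.prob (index_pmf A d1 d2) {(I, J). exact_cur k A (remdups I) (remdups J)}
      \<ge> (1 - 2 * exp (- 1 / \<delta>))\<^sup>2"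
    by (simp add: a_def)
qed

theorem theorem6p1:
  shows "\<exists>C\<^sub>0 c :: real. C\<^sub>0 > 0 \<and> c > 0 \<and>
      (\<forall>(A :: real mat) m n k r \<epsilon> \<delta> d1 d2.
        A \<in> carrier_mat m n \<longrightarrow> A \<noteq> 0\<^sub>m m n \<longrightarrow>
        k = mat_rank A \<longrightarrow> r = stable_rank A \<longrightarrow>
        0 < \<epsilon> \<longrightarrow> \<epsilon> < singular_value k A / spectral_norm A \<longrightarrow>
        0 < \<delta> \<longrightarrow> \<delta> < 1 \<longrightarrow>
        d1 \<in> {1..m} \<longrightarrow> d2 \<in> {1..n} \<longrightarrow>
        real d1 \<ge> C\<^sub>0 * (r / (\<epsilon> ^ 4 * \<delta>)) * ln (r / (\<epsilon> ^ 4 * \<delta>)) \<longrightarrow>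
        real d2 \<ge> C\<^sub>0 * (r / (\<epsilon> ^ 4 * \<delta>)) * ln (r / (\<epsilon> ^ 4 * \<delta>)) \<longrightarrow>
          measure_pmf.prob (index_pmf A d1 d2) {(I, J). exact_cur k A I J}
            \<ge> (1 - 2 * exp (- c / \<delta>)) ^ 2 \<and>
          measure_pmf.prob (index_pmf A d1 d2) {(I, J). exact_cur k A (remdups I) (remdups J)}
            \<ge> (1 - 2 * exp (- c / \<delta>)) ^ 2) \<and>
      (\<forall>(A :: complex mat) m n k r \<epsilon> \<delta> d1 d2.
        A \<in> carrier_mat m n \<longrightarrow> A \<noteq> 0\<^sub>m m n \<longrightarrow>
        k = mat_rank A \<longrightarrow> r = stable_rank A \<longrightarrow>
        0 < \<epsilon> \<longrightarrow> \<epsilon> < singular_value k A / spectral_norm A \<longrightarrow>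
        0 < \<delta> \<longrightarrow> \<delta> < 1 \<longrightarrow>
        d1 \<in> {1..m} \<longrightarrow> d2 \<in> {1..n} \<longrightarrow>
        real d1 \<ge> C\<^sub>0 * (r / (\<epsilon> ^ 4 * \<delta>)) * ln (r / (\<epsilon> ^ 4 * \<delta>)) \<longrightarrow>
        real d2 \<ge> C\<^sub>0 * (r / (\<epsilon> ^ 4 * \<delta>)) * ln (r / (\<epsilon> ^ 4 * \<delta>)) \<longrightarrow>
          measure_pmf.prob (index_pmf A d1 d2) {(I, J). exact_cur k A I J}
            \<ge> (1 - 2 * exp (- c / \<delta>)) ^ 2 \<and>
          measure_pmf.prob (index_pmf A d1 d2) {(I, J). exact_cur k A (remdups I) (remdups J)}
            \<ge> (1 - 2 * exp (- c / \<delta>)) ^ 2)"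
  \<comment> \<open>The witnesses are 3 for the sample size and 1 for the exponent.\<close>
  by (rule exI[of _ 3], rule exI[of _ 1], intro conjI allI impI)
    ((rule prob_exact_cur[OF char_poly_gram_splits_real]
        prob_exact_cur[OF char_poly_gram_splits_complex]; assumption) | simp)+

end
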